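(* Let $N,M\ge 1$ and let $p_1,\dots,p_N\in\mathbb{R}^3$ and $q_1,\dots,q_M\in\mathbb{R}^3$ be the vertices of two closed polygonal curves ($p_{N+1}=p_1$, $q_{M+1}=q_1$) whose images are disjoint. Let $L=L(p,q)$ be their linking number (Gauss double integral). For $1\le i\le N$, $1\le j\le M$ let $[x_{ij},y_{ij},\sigma_{ij}]$ be the triple $\mathrm{tri}(p_i,p_{i+1},q_j,q_{j+1})$ defined in the context (it represents the angle $\Delta\Theta_{ij}=T(p_i,p_{i+1},q_j,q_{j+1})$, that is, $\Delta\Theta_{ij}=\mathcal{A}([x_{ij},y_{ij},\sigma_{ij}])$). Then the triple sum, computed in exact arithmetic, $$[X,Y,\sigma]=\bigoplus_{i=1}^N\bigoplus_{j=1}^M [x_{ij},y_{ij},\sigma_{ij}]$$ satisfies $X>0$, $Y=0$ and $\sigma=L$.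
   Context: **Curves and linking number.** The polygonal curves are $p(t)=p_i+(t-i)(p_{i+1}-p_i)$ for $t\in[i,i+1]$, $i=1,\dots,N$, and $q(s)=q_j+(s-j)(q_{j+1}-q_j)$ for $s\in[j,j+1]$, $j=1,\dots,M$. The linking number is $$L(p,q)=\frac1{4\pi}\int\!\!\int \frac{(q(s)-p(t))\cdot(q'(s)\times p'(t))}{\|q(s)-p(t)\|^3}\,ds\,dt ,$$ the integral being over the full parameter ranges $t\in[1,N+1]$, $s\in[1,M+1]$. It is a standard fact that $L(p,q)$ is an integer for disjoint closed curves. **The angle $T$.** For $p,p',q,q'\in\mathbb{R}^3$ with segments $[p,p']$ and $[q,q']$ disjoint, with $\Delta p=p'-p$, $\Delta q=q'-q$, $$T(p,p',q,q')=\frac12\int_0^1\!\!\int_0^1\frac{(q-p+s\Delta q-t\Delta p)\cdot(\Delta q\times\Delta p)}{\|q-p+s\Delta q-t\Delta p\|^3}\,ds\,dt,$$ so that $L(p,q)=\frac1{2\pi}\sum_{i,j}T(p_i,p_{i+1},q_j,q_{j+1})$. **Angle triples.** $\operatorname{atan2}(y,x)$, for $(x,y)\ne(0,0)$, is the unique $\theta\in(-\pi,\pi]$ with $x=R\cos\theta$, $y=R\sin\theta$ for some $R>0$. A triple is $[x,y,\sigma]\in(\mathbb{R}^2\setminus\{(0,0)\})\times\mathbb{Z}$, representing the angle $\mathcal{A}([x,y,\sigma])=\operatorname{atan2}(y,x)+2\pi\sigma$. **Sign and crossing.** $s(x,y)=+1$ if $y>0$ or ($y=0$ and $x<0$); $s(x,y)=-1$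 if $y<0$ or ($y=0$ and $x>0$). For points $(x,y),(x',y'),(x'',y'')$ of $\mathbb{R}^2\setminus\{(0,0)\}$, $$\mathcal{C}(x,y,x',y',x'',y'')=\begin{cases}s(x,y)&\text{if } s(x,y)s(x',y')>0\text{ and }s(x,y)s(x'',y'')<0,\\0&\text{otherwise.}\end{cases}$$ **Triple sum.** $[x,y,\sigma]\oplus[x',y',\sigma']=[x'',y'',\sigma'']$ with $x''=a(xx'-yy')$, $y''=a(xy'+yx')$, $\sigma''=\sigma+\sigma'+\mathcal{C}(x,y,x',y',x'',y'')$, where $a$ is any positive real number (it may be chosen differently at each sum; the statement holds for every choice of the scalings). **The triple $\mathrm{tri}(p,p',q,q')$** for disjoint segments $[p,p']$, $[q,q']$: put $\alpha=q-p$, $\beta=q-p'$, $\gamma=q'-p'$, $\omega=q'-p$, let $\tilde\alpha,\tilde\beta,\tilde\gamma,\tilde\omega$ be these vectors divided by their Euclidean norms, and $$x=1+\tilde\alpha\cdot\tilde\gamma+\tilde\alpha\cdot\tilde\beta+\tilde\beta\cdot\tilde\gamma,\quad y=\tilde\beta\cdot(\tilde\alpha\times\tilde\gamma),$$ $$x'=1+\tilde\alpha\cdot\tilde\gamma+\tilde\alpha\cdot\tilde\omega+\tilde\omega\cdot\tilde\gamma,\quad y'=\tilde\omega\cdot(\tilde\alpha\times\tilde\gamma),$$ $$x''=xx'+yy',\quad y''=xy'-yx',\quad \sigma''=\begin{cases}-s(x'',y'')&\text{if } s(x'',y'')\,y>0,\\0&\text{otherwise.}\end{cases}$$ Then $\mathrm{tri}(p,p',q,q')=[x'',y'',\sigma'']$.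 *)

theory Defs
  imports "HOL-Analysis.Analysis"
begin

unbundle cross3_syntax

section \<open>Polygonal curves and the linking number\<close>

text \<open>
  The vertices are \<open>p 1, \<dots>, p N\<close>; closedness is the separate assumption \<open>p (N + 1) = p 1\<close>.
  The index \<open>i\<close> of the edge containing \<open>p(t)\<close> is the integer part of \<open>t\<close>; the lemma below
  shows that the formula is also right at the far end \<open>t = i + 1\<close> of the edge.
\<close>

definition polygonal_curve :: "(nat \<Rightarrow> real^3) \<Rightarrow> real \<Rightarrow> real^3" where
  "polygonal_curve p t = (let i = nat \<lfloor>t\<rfloor> in p i + (t - real i) *\<^sub>R (p (i + 1) - p i))"

lemma polygonal_curve_on_edge:
  assumes "real i \<le> t" and "t \<le> real i + 1"
  shows "polygonal_curve p t = p i + (t - real i) *\<^sub>R (p (i + 1) - p i)"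
proof (cases "t = real i + 1")
  case True
  then have "nat \<lfloor>t\<rfloor> = i + 1" by linarith
  then show ?thesis by (simp add: polygonal_curve_def True)
next
  case False
  with assms have "nat \<lfloor>t\<rfloor> = i" by linarith
  then show ?thesis by (simp add: polygonal_curve_def)
qed

text \<open>
  The derivatives do not exist at the finitely many parameters of the corners, where
  \<^const>\<open>vector_derivative\<close> is an unspecified vector; this does not affect the integrals.
\<close>

definition linking_number :: "nat \<Rightarrow> nat \<Rightarrow> (nat \<Rightarrow> real^3) \<Rightarrow> (nat \<Rightarrow> real^3) \<Rightarrow> real" where
  "linking_number N M p q =
     1 / (4 * pi) *
     integral {1..real N + 1} (\<lambda>t. integral {1..real M + 1} (\<lambda>s.
       ((polygonal_curve q s - polygonal_curve p t) \<bullet>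
        (vector_derivative (polygonal_curve q) (at s) \<times>
         vector_derivative (polygonal_curve p) (at t)))
       / norm (polygonal_curve q s - polygonal_curve p t) ^ 3))"

definition gauss_angle :: "real^3 \<Rightarrow> real^3 \<Rightarrow> real^3 \<Rightarrow> real^3 \<Rightarrow> real" where
  "gauss_angle p p' q q' =
     (let \<Delta>p = p' - p; \<Delta>q = q' - q in
      1 / 2 * integral {0..1} (\<lambda>t. integral {0..1} (\<lambda>s.
        ((q - p + s *\<^sub>R \<Delta>q - t *\<^sub>R \<Delta>p) \<bullet> (\<Delta>q \<times> \<Delta>p))
        / norm (q - p + s *\<^sub>R \<Delta>q - t *\<^sub>R \<Delta>p) ^ 3)))"


section \<open>Angle triples\<close>

definition atan2 :: "real \<Rightarrow> real \<Rightarrow> real" where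
  "atan2 y x = (THE \<theta>. - pi < \<theta> \<and> \<theta> \<le> pi \<and> (\<exists>R>0. x = R * cos \<theta> \<and> y = R * sin \<theta>))"

lemma atan2_eq_Arg:
  assumes "(x, y) \<noteq> (0, 0)"
  shows "atan2 y x = Arg (Complex x y)"
  unfolding atan2_def
proof (rule the_equality)
  have nz: "Complex x y \<noteq> 0"
    using assms by (simp add: complex_eq_iff)
  show "- pi < Arg (Complex x y) \<and> Arg (Complex x y) \<le> pi \<and>
        (\<exists>R>0. x = R * cos (Arg (Complex x y)) \<and> y = R * sin (Arg (Complex x y)))"
    using nz by (auto simp: Arg_bounded cos_Arg sin_Arg intro!: exI[of _ "norm (Complex x y)"])
next
  fix \<theta>
  assume \<theta>: "- pi < \<theta> \<and> \<theta> \<le> pi \<and> (\<exists>R>0. x = R * cos \<theta> \<and> y = R * sin \<theta>)"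
  then obtain R where "R > 0" "x = R * cos \<theta>" "y = R * sin \<theta>" by blast
  then have "Complex x y = rcis R \<theta>"
    by (simp add: complex_eq_iff)
  with \<open>R > 0\<close> have "sgn (Complex x y) = cis \<theta>"
    by (simp add: rcis_def sgn_mult sgn_div_norm of_real_def)
  with \<theta> show "\<theta> = Arg (Complex x y)"
    using cis_Arg_unique by metis
qed

type_synonym triple = "real \<times> real \<times> int"

text \<open>Membership of the planar part in the plane without the origin is not part of the type.\<close>

definition is_triple :: "triple \<Rightarrow> bool" where
  "is_triple = (\<lambda>(x, y, \<sigma>). (x, y) \<noteq> (0, 0))"

definition triple_angle :: "triple \<Rightarrow> real" where
  "triple_angle = (\<lambda>(x, y, \<sigma>). atan2 y x + 2 * pi * of_int \<sigma>)"

text \<open>The value at the origin is irrelevant.\<close>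

definition half_plane_sign :: "real \<Rightarrow> real \<Rightarrow> int" where
  "half_plane_sign x y =
     (if y > 0 \<or> (y = 0 \<and> x < 0) then 1
      else if y < 0 \<or> (y = 0 \<and> x > 0) then - 1
      else 0)"

definition crossing :: "real \<Rightarrow> real \<Rightarrow> real \<Rightarrow> real \<Rightarrow> real \<Rightarrow> real \<Rightarrow> int" where
  "crossing x y x' y' x'' y'' =
     (if half_plane_sign x y * half_plane_sign x' y' > 0 \<and>
         half_plane_sign x y * half_plane_sign x'' y'' < 0
      then half_plane_sign x y else 0)"

text \<open>The sum of two triples with scaling factor \<open>a\<close>.\<close>

definition triple_add :: "real \<Rightarrow> triple \<Rightarrow> triple \<Rightarrow> triple" where
  "triple_add a = (\<lambda>(x, y, \<sigma>) (x', y', \<sigma>').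
     let x'' = a * (x * x' - y * y');
         y'' = a * (x * y' + y * x')
     in (x'', y'', \<sigma> + \<sigma>' + crossing x y x' y' x'' y''))"

text \<open>
  \<open>triple_sum a f n\<close> is the sum of \<open>f 1, \<dots>, f n\<close> (\<open>n \<ge> 1\<close>), associated to the left, where
  \<open>a k\<close> is the scaling factor of the addition of \<open>f k\<close> for \<open>2 \<le> k \<le> n\<close>. No neutral
  element enters the sum; the value at \<open>n = 0\<close> is never used.
\<close>

primrec triple_sum :: "(nat \<Rightarrow> real) \<Rightarrow> (nat \<Rightarrow> triple) \<Rightarrow> nat \<Rightarrow> triple" where
  "triple_sum a f 0 = (1, 0, 0)"
| "triple_sum a f (Suc n) =
     (if n = 0 then f 1 else triple_add (a (Suc n)) (triple_sum a f n) (f (Suc n)))"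

definition tri :: "real^3 \<Rightarrow> real^3 \<Rightarrow> real^3 \<Rightarrow> real^3 \<Rightarrow> triple" where
  "tri p p' q q' =
     (let \<alpha> = (q - p) /\<^sub>R norm (q - p);
          \<beta> = (q - p') /\<^sub>R norm (q - p');
          \<gamma> = (q' - p') /\<^sub>R norm (q' - p');
          \<omega> = (q' - p) /\<^sub>R norm (q' - p);
          x = 1 + \<alpha> \<bullet> \<gamma> + \<alpha> \<bullet> \<beta> + \<beta> \<bullet> \<gamma>;
          y = \<beta> \<bullet> (\<alpha> \<times> \<gamma>);
          x' = 1 + \<alpha> \<bullet> \<gamma> + \<alpha> \<bullet> \<omega> + \<omega> \<bullet> \<gamma>;
          y' = \<omega> \<bullet> (\<alpha> \<times> \<gamma>);
          x'' = x * x' + y * y';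
          y'' = x * y' - y * x';
          \<sigma>'' = (if of_int (half_plane_sign x'' y'') * y > 0
                 then - half_plane_sign x'' y'' else 0)
      in (x'', y'', \<sigma>''))"

unbundle no cross3_syntax

end

theory Submission
  imports Defs
begin

text \<open>
  Attach to every \<open>r \<in> \<real>\<^sup>3\<close> a spinor, that is, a vector of \<open>\<complex>\<^sup>2\<close> whose rank-one matrix is
  \<open>|r| + r \<bullet> (Pauli matrices)\<close>. The triangle number \<open>x + i y\<close> in the definition of \<open>tri\<close> is then a
  positive multiple of \<open>\<langle>a|b\<rangle>\<langle>b|c\<rangle>\<langle>c|a\<rangle>\<close>, and the planar part of \<open>tri\<close> is a positive multiple of the
  holonomy \<open>\<langle>a|b\<rangle>\<langle>b|c\<rangle>\<langle>c|d\<rangle>\<langle>d|a\<rangle>\<close> around the parallelogram of differences \<open>q(s) - p(t)\<close>. On the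
  torus of all index pairs every edge is traversed once in each direction, so the product of all
  holonomies is a nonnegative real number: \<open>X > 0\<close> and \<open>Y = 0\<close>.

  The Gauss integral over one pair of edges is an alternating sum of arctangents at the four corners
  of the parallelogram (Girard's formula for the solid angle). The same spinors show that \<open>cis\<close> of
  this sum has the direction of the squared holonomy, so half the sum and the angle of \<open>tri\<close> differ by
  a multiple of \<open>\<pi>\<close>. Letting the parallelogram collapse to a segment, the difference is continuous
  and ends at 0, hence is 0. Addition of triples is exact on angles, so the angle of the total, which is
  \<open>2 \<pi> \<sigma>\<close>, is the sum of the Gauss integrals.
\<close>

unbundle cross3_syntax

section \<open>Spinors\<close>

text \<open>The Hermitian matrix \<open>norm r + r \<bullet> (Pauli matrices)\<close> has trace
  \<open>2 * norm r\<close> and determinant 0, so it is the rank-one matrix of some vector. The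
  vector is chosen with real nonnegative first component, which vanishes only on the negative third
  axis (including 0).\<close>

lemma spinor_exists:
  "\<exists>\<psi>::complex \<times> complex. fst \<psi> * cnj (fst \<psi>) = of_real (norm r + r$3) \<and>
      snd \<psi> * cnj (snd \<psi>) = of_real (norm r - r$3) \<and> fst \<psi> * cnj (snd \<psi>) = Complex (r$1) (- (r$2))"
  for r :: "real^3"
proof -
  have n2: "(norm r)^2 = (r$1)^2 + (r$2)^2 + (r$3)^2"
    by (simp only: power2_norm_eq_inner inner_vec_def sum_3) (simp add: power2_eq_square)
  have ge: "norm r + r$3 \<ge> 0"
    using component_le_norm_cart[of r 3] by linarith
  show ?thesis
  proof (cases "norm r + r$3 = 0")
    case True
    then have "(r$3)^2 = (norm r)^2" by (simp add: add_eq_0_iff)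
    then have "(r$1)^2 + (r$2)^2 = 0" using n2 by simp
    then have "r$1 = 0" "r$2 = 0" by (simp_all add: sum_power2_eq_zero_iff)
    with True show ?thesis
      by (intro exI[of _ "(0, of_real (sqrt (2 * norm r)))"])
        (simp add: complex_eq_iff flip: of_real_mult)
  next
    case False
    define w where "w = sqrt (norm r + r$3)"
    have w: "w > 0" "w * w = norm r + r$3" using False ge by (simp_all add: w_def)
    have "((r$1)^2 + (r$2)^2) / (w * w) = norm r - r$3"
      using False n2 unfolding w(2) by (simp add: field_simps power2_eq_square)
    with w show ?thesis
      by (intro exI[of _ "(of_real w, Complex (r$1) (r$2) / of_real w)"])
        (simp add: complex_eq_iff power2_eq_square add_divide_distrib flip: of_real_mult)
  qed
qed

text \<open>Fixed only up to a phase. In the closed products below each spinor meets its own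
  conjugate, so the phase cancels.\<close>

definition spinor :: "real^3 \<Rightarrow> complex \<times> complex" where
  "spinor r = (SOME \<psi>. fst \<psi> * cnj (fst \<psi>) = of_real (norm r + r$3) \<and>
      snd \<psi> * cnj (snd \<psi>) = of_real (norm r - r$3) \<and> fst \<psi> * cnj (snd \<psi>) = Complex (r$1) (- (r$2)))"

lemma spinor:
  "fst (spinor r) * cnj (fst (spinor r)) = of_real (norm r + r$3)"
  "snd (spinor r) * cnj (snd (spinor r)) = of_real (norm r - r$3)"
  "fst (spinor r) * cnj (snd (spinor r)) = Complex (r$1) (- (r$2))"
  "snd (spinor r) * cnj (fst (spinor r)) = Complex (r$1) (r$2)"
proof -
  show *: "fst (spinor r) * cnj (fst (spinor r)) = of_real (norm r + r$3)"
    "snd (spinor r) * cnj (snd (spinor r)) = of_real (norm r - r$3)"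
    "fst (spinor r) * cnj (snd (spinor r)) = Complex (r$1) (- (r$2))"
    using someI_ex[OF spinor_exists[of r]] unfolding spinor_def by auto
  have "snd (spinor r) * cnj (fst (spinor r)) = cnj (fst (spinor r) * cnj (snd (spinor r)))"
    by simp
  then show "snd (spinor r) * cnj (fst (spinor r)) = Complex (r$1) (r$2)"
    unfolding *(3) by (simp add: complex_eq_iff)
qed

definition spin_inner :: "real^3 \<Rightarrow> real^3 \<Rightarrow> complex" where
  "spin_inner a b = cnj (fst (spinor a)) * fst (spinor b) + cnj (snd (spinor a)) * snd (spinor b)"

definition spin_det :: "real^3 \<Rightarrow> real^3 \<Rightarrow> complex" where
  "spin_det a b = fst (spinor a) * snd (spinor b) - snd (spinor a) * fst (spinor b)"

definition tri_re :: "real^3 \<Rightarrow> real^3 \<Rightarrow> real^3 \<Rightarrow> real" where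
  "tri_re a b c = norm a * norm b * norm c + (a \<bullet> b) * norm c + (b \<bullet> c) * norm a + (c \<bullet> a) * norm b"

text \<open>The classical half-angle formula: the argument is half the signed solid angle of the
  triangle seen from the origin.\<close>

definition tri_cx :: "real^3 \<Rightarrow> real^3 \<Rightarrow> real^3 \<Rightarrow> complex" where
  "tri_cx a b c = Complex (tri_re a b c) (a \<bullet> (b \<times> c))"

lemma cnj_spin_inner: "cnj (spin_inner a b) = spin_inner b a"
  by (simp add: spin_inner_def mult.commute)

lemma spin_det_commute: "spin_det b a = - spin_det a b"
  by (simp add: spin_det_def)

text \<open>The left side is the trace of the product of the three rank-one matrices; the Pauli
  algebra turns it into scalar products plus \<open>\<i>\<close> times the determinant.\<close>

lemma spin_inner_triangle:
  "spin_inner a b * spin_inner b c * spin_inner c a = 2 * tri_cx a b c"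
proof -
  \<comment> \<open>Primed variables stand for conjugates; each bracket on the right is an entry of
    one of the three rank-one matrices.\<close>
  have expand: "(ua' * ub + va' * vb) * (ub' * uc + vb' * vc) * (uc' * ua + vc' * va) =
     (ua * ua') * (ub * ub') * (uc * uc') + (va * ua') * (ub * ub') * (uc * vc')
   + (ua * ua') * (ub * vb') * (vc * uc') + (va * ua') * (ub * vb') * (vc * vc')
   + (ua * va') * (vb * ub') * (uc * uc') + (va * va') * (vb * ub') * (uc * vc')
   + (ua * va') * (vb * vb') * (vc * uc') + (va * va') * (vb * vb') * (vc * vc')"
    for ua ub uc va vb vc ua' ub' uc' va' vb' vc' :: complex
    by (simp add: algebra_simps)
  show ?thesis
    unfolding spin_inner_def expand spinor
    by (simp add: complex_eq_iff tri_cx_def tri_re_def cross3_simps inner_vec_def sum_3 vector_3)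
qed

lemma spin_inner_pair: "spin_inner a b * spin_inner b a = of_real (2 * (norm a * norm b + a \<bullet> b))"
proof -
  have expand: "(ua' * ub + va' * vb) * (ub' * ua + vb' * va) =
     (ua * ua') * (ub * ub') + (va * ua') * (ub * vb')
   + (ua * va') * (vb * ub') + (va * va') * (vb * vb')"
    for ua ub va vb ua' ub' va' vb' :: complex
    by (simp add: algebra_simps)
  show ?thesis
    unfolding spin_inner_def expand spinor
    by (simp add: complex_eq_iff inner_vec_def sum_3 algebra_simps)
qed

lemma spin_inner_self: "spin_inner a a = of_real (2 * norm a)"
  by (simp add: spin_inner_def mult.commute[of "cnj _"] spinor del: complex_mult_cnj)

text \<open>The factors \<open>spin_det\<close> come from the spinor of \<open>- a\<close>; around a closed polygon they pair up to
  squared moduli.\<close>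

lemma spin_corner:
  "spin_inner b a * spin_inner a c * (cnj (spin_det a c) * spin_det a b) =
    4 * Complex ((a \<times> b) \<bullet> (a \<times> c)) (- (norm a * (a \<bullet> (b \<times> c))))"
proof -
  \<comment> \<open>Lagrange's identity for 2 by 2 determinants trades \<open>spin_det\<close> for
    Hermitian products.\<close>
  have e: "cnj (spin_det a c) * spin_det a b =
      spin_inner a a * spin_inner c b - spin_inner c a * spin_inner a b"
    by (simp add: spin_det_def spin_inner_def algebra_simps)
  have "spin_inner b a * spin_inner a c * (cnj (spin_det a c) * spin_det a b) =
     spin_inner a a * (spin_inner b a * spin_inner a c * spin_inner c b)
     - (spin_inner a c * spin_inner c a) * (spin_inner a b * spin_inner b a)"
    unfolding e by (simp add: algebra_simps)
  also have "\<dots> = of_real (2 * norm a) * (2 * tri_cx b a c)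
      - of_real (2 * (norm a * norm c + a \<bullet> c)) * of_real (2 * (norm a * norm b + a \<bullet> b))"
    unfolding spin_inner_triangle spin_inner_pair spin_inner_self ..
  also have "\<dots> = 4 * Complex ((a \<times> b) \<bullet> (a \<times> c)) (- (norm a * (a \<bullet> (b \<times> c))))"
  proof -
    have 1: "b \<bullet> (a \<times> c) = - (a \<bullet> (b \<times> c))"
      by (simp add: cross3_def inner_vec_def sum_3 vector_3 algebra_simps)
    have 2: "(a \<times> b) \<bullet> (a \<times> c) = norm a * norm a * (b \<bullet> c) - (a \<bullet> b) * (a \<bullet> c)"
      by (simp add: dot_cross power2_norm_eq_inner[unfolded power2_eq_square] inner_commute)
    show ?thesis
      unfolding 2 by (simp add: complex_eq_iff tri_cx_def tri_re_def 1 inner_commute[of b a]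
        inner_commute[of c a] inner_commute[of c b] algebra_simps)
  qed
  finally show ?thesis .
qed

definition holonomy :: "real^3 \<Rightarrow> real^3 \<Rightarrow> real^3 \<Rightarrow> real^3 \<Rightarrow> complex" where
  "holonomy a b c d = spin_inner a b * spin_inner b c * spin_inner c d * spin_inner d a"

text \<open>The argument of \<open>corner a b c\<close> is, up to sign, the dihedral angle between the planes \<open>a, b\<close> and
  \<open>a, c\<close>, that is, the angle at \<open>a\<close> of the spherical triangle.\<close>

definition corner :: "real^3 \<Rightarrow> real^3 \<Rightarrow> real^3 \<Rightarrow> complex" where
  "corner a b c = Complex ((a \<times> b) \<bullet> (a \<times> c)) (- (norm a * (a \<bullet> (b \<times> c))))"

text \<open>The triangles \<open>a c b\<close> and \<open>a c d\<close> share a diagonal.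
  Conjugation reverses the first one, so the diagonal is run through both ways and contributes only
  a real factor, by \<open>spin_inner_pair\<close>.\<close>

lemma cnj_tri_cx_mult_tri_cx:
  "cnj (tri_cx a c b) * tri_cx a c d = of_real ((norm a * norm c + a \<bullet> c) / 2) * holonomy a b c d"
proof -
  have "4 * (cnj (tri_cx a c b) * tri_cx a c d) = cnj (2 * tri_cx a c b) * (2 * tri_cx a c d)"
    by simp
  also have "\<dots> = (spin_inner a c * spin_inner c a) * holonomy a b c d"
    unfolding spin_inner_triangle[symmetric] complex_cnj_mult cnj_spin_inner holonomy_def by (simp only: mult_ac)
  also have "\<dots> = 4 * (of_real ((norm a * norm c + a \<bullet> c) / 2) * holonomy a b c d)"
    unfolding spin_inner_pair by simp
  finally show ?thesis by (simp add: mult_ac)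
qed

text \<open>Each \<open>spin_corner\<close> contributes the two sides meeting at its vertex, so
  every side appears twice. The four signs cancel and the determinants pair up to squared
  moduli.\<close>

lemma corner_product:
  "\<exists>k\<ge>0. corner a d b * corner b a c * corner c b d * corner d c a = of_real k * (holonomy a b c d)\<^sup>2"
proof -
  define k where "k = (cmod (spin_det a b) * cmod (spin_det b c) * cmod (spin_det c d) * cmod (spin_det d a))\<^sup>2"
  have k: "of_real k = spin_det a b * cnj (spin_det a b) * (spin_det b c * cnj (spin_det b c)) *
      (spin_det c d * cnj (spin_det c d)) * (spin_det d a * cnj (spin_det d a))"
    unfolding k_def complex_norm_square[symmetric] of_real_power[symmetric] of_real_mult[symmetric] power_mult_distrib ..
  have "256 * (corner a d b * corner b a c * corner c b d * corner d c a) =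
     (4 * corner a d b) * (4 * corner b a c) * (4 * corner c b d) * (4 * corner d c a)"
    by simp
  also have "\<dots> = (spin_inner d a * spin_inner a b * (cnj (spin_det a b) * - spin_det d a)) *
     (spin_inner a b * spin_inner b c * (cnj (spin_det b c) * - spin_det a b)) *
     (spin_inner b c * spin_inner c d * (cnj (spin_det c d) * - spin_det b c)) *
     (spin_inner c d * spin_inner d a * (cnj (spin_det d a) * - spin_det c d))"
    unfolding corner_def spin_corner[symmetric] spin_det_commute[of a d] spin_det_commute[of b a]
      spin_det_commute[of c b] spin_det_commute[of d c] by simp
  also have "\<dots> = of_real k * (holonomy a b c d)\<^sup>2"
    unfolding k holonomy_def power2_eq_square by (simp add: mult_ac)
  finally have "corner a d b * corner b a c * corner c b d * corner d c a =
      of_real (k / 256) * (holonomy a b c d)\<^sup>2"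
    by (simp add: field_simps)
  moreover have "k / 256 \<ge> 0" by (simp add: k_def)
  ultimately show ?thesis by blast
qed

section \<open>The Gauss integrand as a mixed second derivative\<close>

text \<open>Up to sign, the complement to \<open>\<pi> / 2\<close> of the angle at \<open>r\<close> of the spherical image of a
  parallelogram with sides \<open>u\<close> and \<open>v\<close>.\<close>

definition corner_angle :: "real^3 \<Rightarrow> real^3 \<Rightarrow> real^3 \<Rightarrow> real" where
  "corner_angle u v r = arctan (((r \<times> u) \<bullet> (r \<times> v)) / ((r \<bullet> (u \<times> v)) * norm r))"

text \<open>The derivative of \<open>corner_angle\<close> along \<open>v\<close>. One more
  derivative, along \<open>u\<close>, leaves a determinant over a cubed norm, the shape of the Gauss
  integrand.\<close>

definition corner_angle_rate :: "real^3 \<Rightarrow> real^3 \<Rightarrow> real^3 \<Rightarrow> real" where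
  "corner_angle_rate u v r = - (r \<bullet> (u \<times> v)) * (r \<bullet> u) / (norm r * ((r \<times> u) \<bullet> (r \<times> u)))"

lemma triple_det_shift [simp]:
  "(r + s *\<^sub>R u) \<bullet> (u \<times> v) = r \<bullet> (u \<times> v)"
  "(r + t *\<^sub>R v) \<bullet> (u \<times> v) = r \<bullet> (u \<times> v)"
  by (simp_all add: inner_add_left dot_cross_self)

lemma gram_det: "(r \<bullet> (u \<times> v))\<^sup>2 =
    (r \<bullet> r) * (u \<bullet> u) * (v \<bullet> v) + 2 * (r \<bullet> u) * (u \<bullet> v) * (r \<bullet> v)
    - (r \<bullet> r) * (u \<bullet> v)\<^sup>2 - (u \<bullet> u) * (r \<bullet> v)\<^sup>2 - (v \<bullet> v) * (r \<bullet> u)\<^sup>2"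
  by (simp add: cross3_def inner_vec_def sum_3 vector_3 power2_eq_square algebra_simps)

lemma cross_self_inner: "(r \<times> u) \<bullet> (r \<times> u) = (norm r)\<^sup>2 * (u \<bullet> u) - (r \<bullet> u)\<^sup>2"
  by (simp only: dot_cross power2_norm_eq_inner) (simp add: inner_commute power2_eq_square)

lemma has_field_derivative_norm_line:
  fixes r v :: "'a::real_inner"
  assumes "r + t *\<^sub>R v \<noteq> 0"
  shows "((\<lambda>t. norm (r + t *\<^sub>R v)) has_real_derivative ((r + t *\<^sub>R v) \<bullet> v) / norm (r + t *\<^sub>R v)) (at t within S)"
proof -
  have "((\<lambda>t. norm (r + t *\<^sub>R v)) has_derivative (\<lambda>h. h * (((r + t *\<^sub>R v) \<bullet> v) / norm (r + t *\<^sub>R v)))) (at t within S)"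
  proof -
    have "((\<lambda>t. r + t *\<^sub>R v) has_derivative (\<lambda>h. h *\<^sub>R v)) (at t within S)"
      by (auto intro!: derivative_eq_intros)
    from has_derivative_compose[OF this has_derivative_norm[OF assms]] show ?thesis
      by (simp add: sgn_div_norm divide_inverse mult_ac inner_commute[of v])
  qed
  then show ?thesis by (simp only: has_field_derivative_def mult_commute_abs)
qed

lemma corner_angle_deriv:
  fixes r u v :: "real^3"
  assumes D: "r \<bullet> (u \<times> v) \<noteq> 0"
  shows "((\<lambda>t. corner_angle u v (r + t *\<^sub>R v)) has_real_derivative corner_angle_rate u v (r + t *\<^sub>R v)) (at t within S)"
proof -
  define D where "D = r \<bullet> (u \<times> v)"
  define w where "w = r + t *\<^sub>R v"
  have Dw: "w \<bullet> (u \<times> v) = D" by (simp add: w_def D_def)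
  have w0: "w \<noteq> 0" using Dw D by (auto simp: D_def)
  have N: "((\<lambda>t. ((r + t *\<^sub>R v) \<times> u) \<bullet> ((r + t *\<^sub>R v) \<times> v)) has_real_derivative
      (w \<bullet> v) * (u \<bullet> v) - (w \<bullet> u) * (v \<bullet> v)) (at t within S)"
  proof -
    have "((r + t *\<^sub>R v) \<times> u) \<bullet> ((r + t *\<^sub>R v) \<times> v) =
      (r \<times> u) \<bullet> (r \<times> v) + t * ((r \<bullet> v) * (u \<bullet> v) - (r \<bullet> u) * (v \<bullet> v))" for t
      by (simp add: dot_cross inner_simps inner_commute algebra_simps)
    moreover have "(w \<bullet> v) * (u \<bullet> v) - (w \<bullet> u) * (v \<bullet> v) = (r \<bullet> v) * (u \<bullet> v) - (r \<bullet> u) * (v \<bullet> v)"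
      by (simp add: w_def inner_simps inner_commute algebra_simps)
    ultimately show ?thesis by (auto intro!: derivative_eq_intros)
  qed
  have nw: "((\<lambda>t. norm (r + t *\<^sub>R v)) has_real_derivative (w \<bullet> v) / norm w) (at t within S)"
    using has_field_derivative_norm_line w0 unfolding w_def by blast
  define n where "n = (w \<times> u) \<bullet> (w \<times> v)"
  define \<rho> where "\<rho> = norm w"
  have \<rho>: "\<rho> > 0" using w0 by (simp add: \<rho>_def)
  have D0: "D \<noteq> 0" using D by (simp add: D_def)
  have deriv: "((\<lambda>t. corner_angle u v (r + t *\<^sub>R v)) has_real_derivative
     inverse (1 + (n / (D * \<rho>))\<^sup>2) * ((((w \<bullet> v) * (u \<bullet> v) - (w \<bullet> u) * (v \<bullet> v)) * (D * \<rho>) - n * (D * ((w \<bullet> v) / \<rho>))) / (D * \<rho>)\<^sup>2))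
      (at t within S)"
  proof -
    have D\<rho>: "D * norm (r + t *\<^sub>R v) \<noteq> 0" using w0 D0 by (simp add: w_def)
    show ?thesis
      using DERIV_chain2[OF DERIV_arctan DERIV_divide[OF N DERIV_cmult[OF nw, of D] D\<rho>]]
      unfolding corner_angle_def triple_det_shift D_def[symmetric] n_def \<rho>_def w_def power2_eq_square .
  qed
  have n: "n = \<rho>\<^sup>2 * (u \<bullet> v) - (w \<bullet> v) * (w \<bullet> u)"
    by (simp add: n_def \<rho>_def dot_cross power2_norm_eq_inner inner_commute)
  define P where "P = \<rho>\<^sup>2 * (u \<bullet> u) - (w \<bullet> u)\<^sup>2"
  define Q where "Q = \<rho>\<^sup>2 * (v \<bullet> v) - (w \<bullet> v)\<^sup>2"
  have D2: "D\<^sup>2 = \<rho>\<^sup>2 * (u \<bullet> u) * (v \<bullet> v) + 2 * (w \<bullet> u) * (u \<bullet> v) * (w \<bullet> v)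
    - \<rho>\<^sup>2 * (u \<bullet> v)\<^sup>2 - (u \<bullet> u) * (w \<bullet> v)\<^sup>2 - (v \<bullet> v) * (w \<bullet> u)\<^sup>2"
    unfolding Dw[symmetric] gram_det \<rho>_def power2_norm_eq_inner ..
  \<comment> \<open>Both sides are |w x u|^2 |w x v|^2, because (w x u) x (w x v) = D w. The
    numerator computed below shares the factor \<open>Q\<close>, so only \<open>P\<close>
    survives.\<close>
  have PQ: "n\<^sup>2 + D\<^sup>2 * \<rho>\<^sup>2 = P * Q"
    unfolding n D2 P_def Q_def by (simp add: algebra_simps power2_eq_square)
  have nonneg: "0 < n\<^sup>2 + D\<^sup>2 * \<rho>\<^sup>2"
    using D0 \<rho> by (simp add: add_nonneg_pos)
  have num: "((w \<bullet> v) * (u \<bullet> v) - (w \<bullet> u) * (v \<bullet> v)) * \<rho>\<^sup>2 - n * (w \<bullet> v) = - (w \<bullet> u) * Q"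
    unfolding n Q_def by (simp add: algebra_simps power2_eq_square)
  have "inverse (1 + (n / (D * \<rho>))\<^sup>2) * ((((w \<bullet> v) * (u \<bullet> v) - (w \<bullet> u) * (v \<bullet> v)) * (D * \<rho>) - n * (D * ((w \<bullet> v) / \<rho>))) / (D * \<rho>)\<^sup>2)
     = D * (((w \<bullet> v) * (u \<bullet> v) - (w \<bullet> u) * (v \<bullet> v)) * \<rho>\<^sup>2 - n * (w \<bullet> v)) / (\<rho> * (n\<^sup>2 + D\<^sup>2 * \<rho>\<^sup>2))"
  proof -
    have "inverse (1 + (n / (D * \<rho>))\<^sup>2) = (D * \<rho>)\<^sup>2 / (n\<^sup>2 + D\<^sup>2 * \<rho>\<^sup>2)"
      using D0 \<rho> nonneg by (simp add: field_simps power2_eq_square)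
    moreover have "((w \<bullet> v) * (u \<bullet> v) - (w \<bullet> u) * (v \<bullet> v)) * (D * \<rho>) - n * (D * ((w \<bullet> v) / \<rho>)) =
        D * (((w \<bullet> v) * (u \<bullet> v) - (w \<bullet> u) * (v \<bullet> v)) * \<rho>\<^sup>2 - n * (w \<bullet> v)) / \<rho>"
      using \<rho> by (simp add: field_simps power2_eq_square)
    ultimately show ?thesis using D0 \<rho> by simp
  qed
  also have "\<dots> = - D * (w \<bullet> u) / (\<rho> * P)"
    using nonneg \<rho> unfolding num PQ by (auto simp: field_simps)
  also have "\<dots> = corner_angle_rate u v w"
    by (simp add: corner_angle_rate_def Dw cross_self_inner P_def \<rho>_def)
  finally show ?thesis using deriv by (simp add: w_def)
qed

text \<open>Moving along \<open>u\<close> changes neither \<open>r \<times> u\<close> nor the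
  determinant. Only the quotient of \<open>r \<bullet> u\<close> by \<open>norm r\<close> varies,
  and its derivative carries |r x u|^2, which cancels the denominator.\<close>

lemma corner_angle_rate_deriv:
  fixes r u v :: "real^3"
  assumes D: "r \<bullet> (u \<times> v) \<noteq> 0"
  shows "((\<lambda>s. corner_angle_rate u v (r + s *\<^sub>R u)) has_real_derivative - (r \<bullet> (u \<times> v)) / norm (r + s *\<^sub>R u) ^ 3) (at s within S)"
proof -
  define D where "D = r \<bullet> (u \<times> v)"
  define w where "w = r + s *\<^sub>R u"
  have Dw: "w \<bullet> (u \<times> v) = D" by (simp add: w_def D_def)
  have w0: "w \<noteq> 0" using Dw D by (auto simp: D_def)
  define \<rho> where "\<rho> = norm w"
  have \<rho>: "\<rho> > 0" using w0 by (simp add: \<rho>_def)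
  define W where "W = (r \<times> u) \<bullet> (r \<times> u)"
  have W: "W > 0"
  proof -
    have "r \<bullet> (u \<times> v) = (r \<times> u) \<bullet> v"
      by (simp add: cross3_def inner_vec_def sum_3 vector_3 algebra_simps)
    then have "r \<times> u \<noteq> 0" using D by auto
    then show ?thesis by (simp add: W_def)
  qed
  have cr: "(r + s *\<^sub>R u) \<times> u = r \<times> u" for s
    by (simp add: cross_add_left cross_mult_left)
  have nw: "((\<lambda>s. norm (r + s *\<^sub>R u)) has_real_derivative (w \<bullet> u) / norm w) (at s within S)"
    using has_field_derivative_norm_line w0 unfolding w_def by blast
  have "((\<lambda>s. (r + s *\<^sub>R u) \<bullet> u) has_real_derivative u \<bullet> u) (at s within S)"
    unfolding inner_add_left by (auto intro!: derivative_eq_intros)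
  then have "((\<lambda>s. corner_angle_rate u v (r + s *\<^sub>R u)) has_real_derivative
      (- D * (u \<bullet> u) * (\<rho> * W) - - D * (w \<bullet> u) * ((w \<bullet> u) / \<rho> * W)) / (\<rho> * W)\<^sup>2) (at s within S)"
    unfolding corner_angle_rate_def triple_det_shift cr W_def[symmetric] D_def[symmetric]
    by - (rule derivative_eq_intros nw refl | assumption |
      (use \<rho> W in \<open>simp_all add: w_def[symmetric] \<rho>_def[symmetric] power2_eq_square\<close>))+
  also have "(- D * (u \<bullet> u) * (\<rho> * W) - - D * (w \<bullet> u) * ((w \<bullet> u) / \<rho> * W)) / (\<rho> * W)\<^sup>2
      = - D * (\<rho>\<^sup>2 * (u \<bullet> u) - (w \<bullet> u)\<^sup>2) / (\<rho>^3 * W)"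
    using \<rho> W by (simp add: field_simps power2_eq_square power3_eq_cube)
  also have "\<rho>\<^sup>2 * (u \<bullet> u) - (w \<bullet> u)\<^sup>2 = W"
    by (metis W_def \<rho>_def cr cross_self_inner w_def)
  also have "- D * W / (\<rho>^3 * W) = - D / \<rho>^3" using W by simp
  finally show ?thesis by (simp add: D_def \<rho>_def w_def)
qed

lemma corner_angle_rate_has_integral:
  fixes r u v :: "real^3"
  assumes D: "r \<bullet> (u \<times> v) \<noteq> 0"
  shows "((\<lambda>s. - (r \<bullet> (u \<times> v)) / norm (r + s *\<^sub>R u + t *\<^sub>R v) ^ 3) has_integral
      corner_angle_rate u v (r + u + t *\<^sub>R v) - corner_angle_rate u v (r + t *\<^sub>R v)) {0..1}"
proof -
  have "((\<lambda>s. - ((r + t *\<^sub>R v) \<bullet> (u \<times> v)) / norm (r + t *\<^sub>R v + s *\<^sub>R u) ^ 3) has_integral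
      corner_angle_rate u v (r + t *\<^sub>R v + 1 *\<^sub>R u) - corner_angle_rate u v (r + t *\<^sub>R v + 0 *\<^sub>R u)) {0..1}"
  proof (intro fundamental_theorem_of_calculus)
    have "(r + t *\<^sub>R v) \<bullet> (u \<times> v) \<noteq> 0" using D by simp
    then show "((\<lambda>s. corner_angle_rate u v (r + t *\<^sub>R v + s *\<^sub>R u)) has_vector_derivative
        - ((r + t *\<^sub>R v) \<bullet> (u \<times> v)) / norm (r + t *\<^sub>R v + s *\<^sub>R u) ^ 3) (at s within {0..1})" for s
      unfolding has_real_derivative_iff_has_vector_derivative[symmetric] by (rule corner_angle_rate_deriv)
  qed simp
  then show ?thesis by (simp add: add_ac)
qed

text \<open>Mixed difference over the parallelogram with sides \<open>u\<close> and
  \<open>t v\<close>, equal to 0 at \<open>t = 0\<close>. Keeping \<open>t\<close> variable prepares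
  the collapse of the parallelogram.\<close>

definition corner_angle_sum :: "real^3 \<Rightarrow> real^3 \<Rightarrow> real^3 \<Rightarrow> real \<Rightarrow> real" where
  "corner_angle_sum u v r t = corner_angle u v (r + u + t *\<^sub>R v) - corner_angle u v (r + t *\<^sub>R v)
     - (corner_angle u v (r + u) - corner_angle u v r)"

lemma corner_angle_sum_deriv:
  assumes D: "r \<bullet> (u \<times> v) \<noteq> 0"
  shows "(corner_angle_sum u v r has_real_derivative
     corner_angle_rate u v (r + u + t *\<^sub>R v) - corner_angle_rate u v (r + t *\<^sub>R v)) (at t within S)"
proof -
  have "(r + u) \<bullet> (u \<times> v) \<noteq> 0" using D triple_det_shift(1)[of r 1 u v] by simp
  from DERIV_diff[OF DERIV_diff[OF corner_angle_deriv[OF this] corner_angle_deriv[OF D]] DERIV_const]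
  show ?thesis unfolding corner_angle_sum_def by simp
qed

lemma corner_angle_sum_has_integral:
  assumes D: "r \<bullet> (u \<times> v) \<noteq> 0"
  shows "((\<lambda>t. corner_angle_rate u v (r + u + t *\<^sub>R v) - corner_angle_rate u v (r + t *\<^sub>R v)) has_integral
      corner_angle_sum u v r 1) {0..1}"
proof -
  have "((\<lambda>t. corner_angle_rate u v (r + u + t *\<^sub>R v) - corner_angle_rate u v (r + t *\<^sub>R v)) has_integral
      corner_angle_sum u v r 1 - corner_angle_sum u v r 0) {0..1}"
    by (intro fundamental_theorem_of_calculus)
      (simp_all add: has_real_derivative_iff_has_vector_derivative[symmetric] corner_angle_sum_deriv[OF D])
  then show ?thesis by (simp add: corner_angle_sum_def)
qed

definition gauss_integrand :: "real^3 \<Rightarrow> real^3 \<Rightarrow> real^3 \<Rightarrow> real^3 \<Rightarrow> real \<Rightarrow> real \<Rightarrow> real" where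
  "gauss_integrand p p' q q' t s =
     ((q - p + s *\<^sub>R (q' - q) - t *\<^sub>R (p' - p)) \<bullet> ((q' - q) \<times> (p' - p)))
        / norm (q - p + s *\<^sub>R (q' - q) - t *\<^sub>R (p' - p)) ^ 3"

text \<open>With \<open>v = p - p'\<close> the difference vector is \<open>r + s u + t v\<close>;
  multiples of \<open>u\<close> and \<open>v\<close> do not change its determinant with them, so the
  numerator is constant.\<close>

lemma gauss_integrand_eq:
  "gauss_integrand p p' q q' t s =
    - ((q - p) \<bullet> ((q' - q) \<times> (p - p'))) / norm (q - p + s *\<^sub>R (q' - q) + t *\<^sub>R (p - p')) ^ 3"
proof -
  have 1: "q - p + s *\<^sub>R (q' - q) - t *\<^sub>R (p' - p) = q - p + s *\<^sub>R (q' - q) + t *\<^sub>R (p - p')"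
    by (simp add: algebra_simps)
  have 2: "w \<bullet> ((q' - q) \<times> (p' - p)) = - (w \<bullet> ((q' - q) \<times> (p - p')))" for w
    by (simp add: cross3_def inner_vec_def sum_3 vector_3 algebra_simps)
  show ?thesis unfolding gauss_integrand_def 1 2 by simp
qed

text \<open>The inner integral is handed out as a function \<open>h\<close>, so that the iterated
  integral over a whole curve can later be glued from its edges.\<close>

lemma gauss_angle_has_integral:
  obtains h where "\<And>t. (gauss_integrand p p' q q' t has_integral h t) {0..1}"
    and "(h has_integral 2 * gauss_angle p p' q q') {0..1}"
    and "2 * gauss_angle p p' q q' = (if (q - p) \<bullet> ((q' - q) \<times> (p - p')) = 0 then 0
           else corner_angle_sum (q' - q) (p - p') (q - p) 1)"
proof -
  define D where "D = (q - p) \<bullet> ((q' - q) \<times> (p - p'))"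
  \<comment> \<open>For coplanar edges the integrand is identically 0, whereas
    \<open>corner_angle\<close> would divide by 0.\<close>
  define h where "h t = (if D = 0 then 0 else
    corner_angle_rate (q' - q) (p - p') (q - p + (q' - q) + t *\<^sub>R (p - p')) - corner_angle_rate (q' - q) (p - p') (q - p + t *\<^sub>R (p - p')))" for t
  define I where "I = (if D = 0 then 0 else corner_angle_sum (q' - q) (p - p') (q - p) 1)"
  have h: "(gauss_integrand p p' q q' t has_integral h t) {0..1}" for t
    using corner_angle_rate_has_integral[of "q - p" "q' - q" "p - p'" t]
    unfolding h_def D_def gauss_integrand_eq[abs_def] by simp
  have I: "(h has_integral I) {0..1}"
    using corner_angle_sum_has_integral[of "q - p" "q' - q" "p - p'"]
    unfolding h_def[abs_def] I_def D_def[symmetric] by (cases "D = 0") simp_all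
  have "2 * gauss_angle p p' q q' = integral {0..1} (\<lambda>t. integral {0..1} (gauss_integrand p p' q q' t))"
    by (simp add: gauss_angle_def gauss_integrand_def[abs_def] Let_def)
  also have "\<dots> = I" unfolding integral_unique[OF h] using integral_unique[OF I] by (simp add: eta_contract_eq)
  finally have eq: "2 * gauss_angle p p' q q' = I" .
  show ?thesis using that[OF h] I eq unfolding I_def D_def by auto
qed

section \<open>From arctangents back to holonomies\<close>

lemma Complex_eq_cis_arctan:
  assumes "k > 0"
  shows "Complex k n = of_real (sqrt (k\<^sup>2 + n\<^sup>2)) * cis (arctan (n / k))"
proof -
  have s: "sqrt (1 + (n / k)\<^sup>2) = sqrt (k\<^sup>2 + n\<^sup>2) / k"
    using assms by (simp add: field_simps real_sqrt_divide)
  have "sqrt (k\<^sup>2 + n\<^sup>2) > 0" using assms by (simp add: add_pos_nonneg)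
  then show ?thesis using assms
    by (simp add: complex_eq_iff cos_arctan sin_arctan s)
qed

text \<open>\<open>arctan\<close> sees only a quotient, so the direction is recovered up to the sign
  of the determinant. This sign is common to the four corners of a parallelogram and drops out of
  their product.\<close>

lemma cis_corner_angle:
  assumes "r \<bullet> (u \<times> v) \<noteq> 0"
  obtains k where "k > 0" and "Complex ((r \<bullet> (u \<times> v)) * norm r) ((r \<times> u) \<bullet> (r \<times> v)) =
     of_real (sgn (r \<bullet> (u \<times> v)) * k) * cis (corner_angle u v r)"
proof -
  define D where "D = r \<bullet> (u \<times> v)"
  define n where "n = (r \<times> u) \<bullet> (r \<times> v)"
  have D: "D \<noteq> 0" using assms by (simp add: D_def)
  then have r: "norm r > 0" by (auto simp: D_def)
  have pos: "sgn D * D * norm r > 0" using D r by (simp add: sgn_if)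
  have "Complex (sgn D * D * norm r) (sgn D * n) =
     of_real (sqrt ((sgn D * D * norm r)\<^sup>2 + (sgn D * n)\<^sup>2)) * cis (arctan ((sgn D * n) / (sgn D * D * norm r)))"
    by (rule Complex_eq_cis_arctan[OF pos])
  also have "(sgn D * n) / (sgn D * D * norm r) = n / (D * norm r)" using D by (simp add: sgn_if)
  finally have "of_real (sgn D) * Complex (D * norm r) n =
      of_real (sqrt ((sgn D * D * norm r)\<^sup>2 + (sgn D * n)\<^sup>2)) * cis (corner_angle u v r)"
    by (simp add: corner_angle_def D_def n_def complex_eq_iff)
  moreover have "of_real (sgn D) * of_real (sgn D) = (1::complex)" using D by (simp add: sgn_if)
  ultimately have "Complex (D * norm r) n =
      of_real (sgn D * sqrt ((sgn D * D * norm r)\<^sup>2 + (sgn D * n)\<^sup>2)) * cis (corner_angle u v r)"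
    by (metis (no_types, lifting) mult.assoc mult_1 of_real_mult)
  moreover have "sqrt ((sgn D * D * norm r)\<^sup>2 + (sgn D * n)\<^sup>2) > 0"
    using zero_less_power[OF pos, of 2] by (simp add: add_pos_nonneg)
  ultimately show ?thesis using that unfolding D_def n_def by blast
qed

text \<open>\<open>corner\<close> depends bilinearly on the edges leaving its vertex, here multiples
  of \<open>u\<close> and \<open>v\<close>. Their orientation alternates around the parallelogram;
  the resulting conjugates match the alternating signs of \<open>corner_angle_sum\<close>.\<close>

lemma corner_parallelogram:
  assumes "b = a + t *\<^sub>R v" "c = a + u + t *\<^sub>R v" "d = a + u"
  shows "corner a d b = of_real t * (- \<i> * Complex ((a \<bullet> (u \<times> v)) * norm a) ((a \<times> u) \<bullet> (a \<times> v)))"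
    and "corner b a c = of_real t * (- \<i> * cnj (Complex ((b \<bullet> (u \<times> v)) * norm b) ((b \<times> u) \<bullet> (b \<times> v))))"
    and "corner c b d = of_real t * (- \<i> * Complex ((c \<bullet> (u \<times> v)) * norm c) ((c \<times> u) \<bullet> (c \<times> v)))"
    and "corner d c a = of_real t * (- \<i> * cnj (Complex ((d \<bullet> (u \<times> v)) * norm d) ((d \<times> u) \<bullet> (d \<times> v))))"
proof -
  have *: "corner w (w + k *\<^sub>R x) (w + l *\<^sub>R y) =
     of_real (k * l) * Complex ((w \<times> x) \<bullet> (w \<times> y)) (- ((w \<bullet> (x \<times> y)) * norm w))" for w x y k l
    by (simp add: corner_def cross_add_left cross_add_right cross_mult_left cross_mult_right inner_add_right
        dot_cross_self complex_eq_iff algebra_simps)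
  have sw: "w \<bullet> (v \<times> u) = - (w \<bullet> (u \<times> v))" for w
    by (metis cross_skew inner_minus_right)
  have "corner a d b = corner a (a + 1 *\<^sub>R u) (a + t *\<^sub>R v)" using assms by simp
  then show "corner a d b = of_real t * (- \<i> * Complex ((a \<bullet> (u \<times> v)) * norm a) ((a \<times> u) \<bullet> (a \<times> v)))"
    unfolding * by (simp add: complex_eq_iff)
  have "corner b a c = corner b (b + (-t) *\<^sub>R v) (b + 1 *\<^sub>R u)" using assms by (simp add: algebra_simps)
  then show "corner b a c = of_real t * (- \<i> * cnj (Complex ((b \<bullet> (u \<times> v)) * norm b) ((b \<times> u) \<bullet> (b \<times> v))))"
    unfolding * by (simp add: complex_eq_iff sw inner_commute)
  have "corner c b d = corner c (c + (-1) *\<^sub>R u) (c + (-t) *\<^sub>R v)" using assms by (simp add: algebra_simps)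
  then show "corner c b d = of_real t * (- \<i> * Complex ((c \<bullet> (u \<times> v)) * norm c) ((c \<times> u) \<bullet> (c \<times> v)))"
    unfolding * by (simp add: complex_eq_iff)
  have "corner d c a = corner d (d + t *\<^sub>R v) (d + (-1) *\<^sub>R u)" using assms by (simp add: algebra_simps)
  then show "corner d c a = of_real t * (- \<i> * cnj (Complex ((d \<bullet> (u \<times> v)) * norm d) ((d \<times> u) \<bullet> (d \<times> v))))"
    unfolding * by (simp add: complex_eq_iff sw inner_commute)
qed

text \<open>The product of the four \<open>corner\<close> numbers is computed twice: from the
  arctangents and from \<open>corner_product\<close>. The factors \<open>- \<i>\<close> and the
  determinant signs occur four times each and cancel.\<close>

lemma cis_corner_angle_sum:
  assumes D: "r \<bullet> (u \<times> v) \<noteq> 0" and t: "t > 0"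
  obtains k where "k > 0"
    and "cis (corner_angle_sum u v r t) =
      of_real k * (holonomy r (r + t *\<^sub>R v) (r + u + t *\<^sub>R v) (r + u))\<^sup>2"
proof -
  define b c d where "b = r + t *\<^sub>R v" and "c = r + u + t *\<^sub>R v" and "d = r + u"
  define \<delta> where "\<delta> = r \<bullet> (u \<times> v)"
  have dets: "b \<bullet> (u \<times> v) = \<delta>" "c \<bullet> (u \<times> v) = \<delta>" "d \<bullet> (u \<times> v) = \<delta>"
    using triple_det_shift(1)[of r 1 u v] by (simp_all add: b_def c_def d_def \<delta>_def)
  have \<delta>: "\<delta> \<noteq> 0" using D by (simp add: \<delta>_def)
  obtain ka kb kc kd where k: "ka > 0" "kb > 0" "kc > 0" "kd > 0"
    and ca: "Complex (\<delta> * norm r) ((r \<times> u) \<bullet> (r \<times> v)) = of_real (sgn \<delta> * ka) * cis (corner_angle u v r)"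
    and cb: "Complex (\<delta> * norm b) ((b \<times> u) \<bullet> (b \<times> v)) = of_real (sgn \<delta> * kb) * cis (corner_angle u v b)"
    and cc: "Complex (\<delta> * norm c) ((c \<times> u) \<bullet> (c \<times> v)) = of_real (sgn \<delta> * kc) * cis (corner_angle u v c)"
    and cd: "Complex (\<delta> * norm d) ((d \<times> u) \<bullet> (d \<times> v)) = of_real (sgn \<delta> * kd) * cis (corner_angle u v d)"
    using cis_corner_angle[of r u v] cis_corner_angle[of b u v] cis_corner_angle[of c u v] cis_corner_angle[of d u v]
    unfolding dets \<delta>_def[symmetric] using \<delta> by metis
  define K where "K = t ^ 4 * (ka * kb * kc * kd)"
  have K: "K > 0" using k t by (simp add: K_def)
  note cp = corner_parallelogram[OF b_def c_def d_def, unfolded dets \<delta>_def[symmetric] ca cb cc cd]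
  have "sgn \<delta> * sgn \<delta> * (sgn \<delta> * sgn \<delta>) = 1" using \<delta> by (simp add: sgn_if)
  then have sg: "complex_of_real (sgn \<delta>) * (complex_of_real (sgn \<delta>) * (complex_of_real (sgn \<delta>) * complex_of_real (sgn \<delta>))) = 1"
    by (metis mult.assoc of_real_1 of_real_mult)
  have cs: "cis (corner_angle_sum u v r t) = cis (corner_angle u v r) * cis (- corner_angle u v b) *
      cis (corner_angle u v c) * cis (- corner_angle u v d)"
    by (simp add: corner_angle_sum_def b_def c_def d_def cis_mult algebra_simps)
  have "corner r d b * corner b r c * corner c b d * corner d c r =
      of_real (t^4) * (of_real (sgn \<delta>) * (of_real (sgn \<delta>) * (of_real (sgn \<delta>) * of_real (sgn \<delta>)))) *
      of_real (ka * kb * kc * kd) * cis (corner_angle_sum u v r t)"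
    unfolding cp cs by (simp add: cis_cnj power4_eq_xxxx mult_ac)
  also have "\<dots> = of_real K * cis (corner_angle_sum u v r t)"
    unfolding sg K_def by simp
  finally have "of_real K * cis (corner_angle_sum u v r t) = corner r d b * corner b r c * corner c b d * corner d c r" ..
  moreover obtain l where l: "l \<ge> 0"
    "corner r d b * corner b r c * corner c b d * corner d c r = of_real l * (holonomy r b c d)\<^sup>2"
    using corner_product by blast
  ultimately have eq: "cis (corner_angle_sum u v r t) = of_real (l / K) * (holonomy r b c d)\<^sup>2"
    using K by (simp add: field_simps)
  \<comment> \<open>\<open>corner_product\<close> only gives \<open>l \<ge> 0\<close>, but
    \<open>l = 0\<close> would make a value of \<open>cis\<close> vanish.\<close>
  then have "l \<noteq> 0" using cis_neq_zero by (metis div_0 mult_zero_left of_real_0)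
  with l K have "l / K > 0" by simp
  with eq that show ?thesis unfolding b_def c_def d_def by blast
qed

section \<open>The solid angle of a parallelogram\<close>

lemma cis_eqI_scaled:
  assumes "cis a = of_real k * z" "cis b = of_real l * z" "k > 0" "l > 0"
  shows "cis a = cis b"
proof -
  have "cis a = of_real (k / l) * cis b" using assms by simp
  moreover from arg_cong[OF this, of norm] have "k / l = 1"
    using assms(3,4) by (simp only: norm_mult norm_cis norm_of_real) simp
  ultimately show ?thesis by (simp only: of_real_1 mult_1)
qed

lemma cis_Arg_diff:
  assumes "z \<noteq> 0" "w \<noteq> 0"
  shows "cis (Arg z - Arg w) = of_real (1 / (norm z * norm w)) * (cnj w * z)"
proof -
  have "cis (Arg z - Arg w) = cis (Arg z) * cnj (cis (Arg w))" by (simp add: cis_cnj cis_mult)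
  also have "\<dots> = of_real (1 / (norm z * norm w)) * (cnj w * z)"
    using assms by (simp add: cis_Arg sgn_div_norm scaleR_conv_of_real divide_inverse mult_ac)
  finally show ?thesis .
qed

lemma cis_eq_cis_iff: "cis a = cis b \<longleftrightarrow> (\<exists>n::int. a = b + 2 * pi * n)"
  unfolding sin_cos_eq_iff[symmetric] by (auto simp: complex_eq_iff)

lemma continuous_on_tri_cx [continuous_intros]:
  fixes f g h :: "'a::t2_space \<Rightarrow> real^3"
  assumes [continuous_intros]: "continuous_on S f" "continuous_on S g" "continuous_on S h"
  shows "continuous_on S (\<lambda>t. tri_cx (f t) (g t) (h t))"
  unfolding tri_cx_def tri_re_def Complex_eq by (intro continuous_intros continuous_on_cross)

text \<open>Strict Cauchy-Schwarz: expanding the squared norm of the vector in the last hypothesis,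
  which is 0 only for antiparallel \<open>a\<close> and \<open>b\<close>.\<close>

lemma norm_mult_add_inner_pos:
  fixes a b :: "'a::real_inner"
  assumes "a \<noteq> 0" "b \<noteq> 0" "norm b *\<^sub>R a + norm a *\<^sub>R b \<noteq> 0"
  shows "norm a * norm b + a \<bullet> b > 0"
proof -
  have "0 < (norm b *\<^sub>R a + norm a *\<^sub>R b) \<bullet> (norm b *\<^sub>R a + norm a *\<^sub>R b)"
    using assms by simp
  also have "\<dots> = 2 * (norm a * norm b) * (norm a * norm b + a \<bullet> b)"
    by (simp add: inner_simps inner_commute[of b a] dot_square_norm[of a] dot_square_norm[of b] power2_eq_square algebra_simps)
  finally show ?thesis using assms by (simp add: zero_less_mult_iff mult_less_0_iff)
qed

lemma corner_angle_sum_eq_Arg: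
  fixes r u v :: "real^3"
  assumes D: "r \<bullet> (u \<times> v) \<noteq> 0"
  shows "corner_angle_sum u v r 1 / 2 =
    Arg (tri_cx r (r + u + v) (r + u)) - Arg (tri_cx r (r + u + v) (r + v))"
proof -
  \<comment> \<open>\<open>P\<close> and \<open>Q\<close> belong to the two triangles cut off by the
    diagonal from \<open>r\<close> to the moving corner; \<open>t = 0\<close> is the collapsed
    parallelogram.\<close>
  define P where "P t = tri_cx r (r + u + t *\<^sub>R v) (r + u)" for t
  define Q where "Q t = tri_cx r (r + u + t *\<^sub>R v) (r + t *\<^sub>R v)" for t
  define g where "g t = corner_angle_sum u v r t / 2 - (Arg (P t) - Arg (Q t))" for t
  have ImP: "Im (P t) = - t * (r \<bullet> (u \<times> v))" for t
    by (simp add: P_def tri_cx_def cross3_def inner_vec_def sum_3 vector_3 algebra_simps)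
  have ImQ: "Im (Q t) = t * (r \<bullet> (u \<times> v))" for t
    by (simp add: Q_def tri_cx_def cross3_def inner_vec_def sum_3 vector_3 algebra_simps)
  have r0: "r \<noteq> 0" using D by auto
  have d0: "r + u \<noteq> 0" using D triple_det_shift(1)[of r 1 u v] by auto
  \<comment> \<open>If \<open>r\<close> and \<open>r + u\<close> were antiparallel, the inner
    product with \<open>u \<times> v\<close> would make a positive multiple of the determinant
    vanish.\<close>
  have "norm (r + u) *\<^sub>R r + norm r *\<^sub>R (r + u) \<noteq> 0"
  proof
    assume "norm (r + u) *\<^sub>R r + norm r *\<^sub>R (r + u) = 0"
    then have "(norm (r + u) *\<^sub>R r + norm r *\<^sub>R (r + u)) \<bullet> (u \<times> v) = 0" by simp
    then have "(norm (r + u) + norm r) * (r \<bullet> (u \<times> v)) = 0"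
      by (simp add: inner_add_left dot_cross_self algebra_simps)
    moreover have "norm (r + u) + norm r > 0" using r0 by (simp add: add_nonneg_pos)
    ultimately show False using D by simp
  qed
  then have pos: "norm r * norm (r + u) + r \<bullet> (r + u) > 0"
    using r0 d0 by (intro norm_mult_add_inner_pos)
  have P0: "P 0 = of_real (2 * norm (r + u) * (norm r * norm (r + u) + r \<bullet> (r + u)))"
    by (simp add: P_def tri_cx_def tri_re_def complex_eq_iff cross_refl inner_commute
        power2_norm_eq_inner[symmetric] power2_eq_square algebra_simps del: inner_commute)
      (simp add: inner_commute)
  have Q0: "Q 0 = of_real (2 * norm r * (norm r * norm (r + u) + r \<bullet> (r + u)))"
    by (simp add: Q_def tri_cx_def tri_re_def complex_eq_iff dot_cross_self inner_commute[of "r + u" r] inner_commute[of u r]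
        power2_norm_eq_inner[symmetric, of r] power2_eq_square algebra_simps)
  have PQ0: "Arg (P 0) = 0" "Arg (Q 0) = 0" "P 0 \<notin> \<real>\<^sub>\<le>\<^sub>0" "Q 0 \<notin> \<real>\<^sub>\<le>\<^sub>0"
    unfolding P0 Q0 using pos r0 d0 by (simp_all add: Arg_eq_0 complex_nonpos_Reals_iff zero_less_mult_iff mult_less_0_iff not_le
      del: of_real_mult)
  \<comment> \<open>For \<open>t \<noteq> 0\<close> the imaginary part is nonzero; at
    \<open>t = 0\<close> the number is a positive real. So the branch cut of \<open>Arg\<close> is
    never met.\<close>
  have nP: "P t \<notin> \<real>\<^sub>\<le>\<^sub>0" and nQ: "Q t \<notin> \<real>\<^sub>\<le>\<^sub>0" for t
    using D PQ0 ImP[of t] ImQ[of t] by (cases "t = 0"; auto simp: complex_nonpos_Reals_iff)+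
  have "continuous_on {0..1} (\<lambda>t. Arg (P t))" "continuous_on {0..1} (\<lambda>t. Arg (Q t))"
    using nP nQ unfolding P_def Q_def
    by (intro continuous_on_compose2[OF continuous_at_imp_continuous_on[of "- \<real>\<^sub>\<le>\<^sub>0" Arg]] continuous_intros;
       auto intro: continuous_at_Arg)+
  moreover have "continuous_on {0..1} (corner_angle_sum u v r)"
    by (rule DERIV_continuous_on[OF corner_angle_sum_deriv[OF D]])
  ultimately have cont: "continuous_on {0..1} g"
    unfolding g_def[abs_def] by (intro continuous_on_diff continuous_on_divide continuous_on_const; simp)
  have g0: "g 0 = 0" by (simp add: g_def PQ0 corner_angle_sum_def)
  \<comment> \<open>For \<open>t > 0\<close>, \<open>corner_angle_sum\<close> and twice the
    difference of arguments both have the direction of the squared holonomy; halving leaves a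
    multiple of \<open>pi\<close>.\<close>
  have gpi: "\<exists>n::int. g t = pi * n" if "t \<in> {0..1}" for t
  proof (cases "t = 0")
    case True
    then show ?thesis using g0 by (intro exI[of _ 0]) simp
  next
    case False
    then have t: "t > 0" using that by simp
    define H where "H = holonomy r (r + t *\<^sub>R v) (r + u + t *\<^sub>R v) (r + u)"
    obtain k where k: "k > 0" "cis (corner_angle_sum u v r t) = of_real k * H\<^sup>2"
      using cis_corner_angle_sum[OF D t] unfolding H_def by blast
    define m where "m = (norm r * norm (r + u + t *\<^sub>R v) + r \<bullet> (r + u + t *\<^sub>R v)) / 2"
    have m: "cnj (Q t) * P t = of_real m * H"
      unfolding P_def Q_def m_def H_def by (rule cnj_tri_cx_mult_tri_cx)
    have nz: "P t \<noteq> 0" "Q t \<noteq> 0" using nP[of t] nQ[of t] by auto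
    have "m \<noteq> 0" using m nz by auto
    \<comment> \<open>The square is positive for either sign of \<open>m\<close>.\<close>
    define l where "l = (m / (norm (P t) * norm (Q t)))\<^sup>2"
    have "cis (2 * (Arg (P t) - Arg (Q t))) = (cis (Arg (P t) - Arg (Q t)))\<^sup>2"
      by (simp add: Complex.DeMoivre)
    also have "\<dots> = of_real l * H\<^sup>2"
      unfolding cis_Arg_diff[OF nz] m l_def by (simp add: power2_eq_square)
    finally have "cis (2 * (Arg (P t) - Arg (Q t))) = of_real l * H\<^sup>2" .
    moreover have "l > 0" using \<open>m \<noteq> 0\<close> nz by (simp add: l_def)
    ultimately have "cis (corner_angle_sum u v r t) = cis (2 * (Arg (P t) - Arg (Q t)))"
      using k cis_eqI_scaled by blast
    then obtain n :: int where "corner_angle_sum u v r t = 2 * (Arg (P t) - Arg (Q t)) + 2 * pi * n"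
      unfolding cis_eq_cis_iff by blast
    then show ?thesis by (intro exI[of _ n]) (simp add: g_def field_simps)
  qed
  \<comment> \<open>Distinct multiples of \<open>pi\<close> are at least \<open>pi\<close> apart, so
    a continuous function with such values cannot change.\<close>
  have "g constant_on {0..1}"
  proof (rule continuous_discrete_range_constant[OF _ cont])
    fix x :: real assume x: "x \<in> {0..1}"
    have "pi \<le> norm (g y - g x)" if y: "y \<in> {0..1}" "g y \<noteq> g x" for y
    proof -
      obtain m n :: int where mn: "g x = pi * m" "g y = pi * n" using gpi x y by blast
      then have "m \<noteq> n" using y by auto
      then have "1 \<le> \<bar>n - m\<bar>" by linarith
      then have "1 \<le> \<bar>real_of_int n - real_of_int m\<bar>"
        by (metis of_int_1_le_iff of_int_abs of_int_diff)
      then have "pi * 1 \<le> pi * \<bar>real_of_int n - real_of_int m\<bar>" by (intro mult_left_mono) simp_all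
      then show ?thesis unfolding mn by (simp add: abs_mult flip: right_diff_distrib)
    qed
    then show "\<exists>e>0. \<forall>y. y \<in> {0..1} \<and> g y \<noteq> g x \<longrightarrow> e \<le> norm (g y - g x)"
      using pi_gt_zero by blast
  qed simp
  then have "g 1 = g 0" unfolding constant_on_def by (metis atLeastAtMost_iff order_refl zero_le_one)
  then show ?thesis unfolding g0 by (simp add: g_def P_def Q_def)
qed

section \<open>Triangle numbers that avoid the branch cut\<close>

lemma linear_dependence_of_triple_product_eq_0:
  fixes a b c :: "real^3"
  assumes "a \<bullet> (b \<times> c) = 0" "b \<noteq> 0"
  obtains x y z where "(x, y, z) \<noteq> (0, 0, 0)" "x *\<^sub>R a + y *\<^sub>R b + z *\<^sub>R c = 0"
proof (cases "b \<times> c = 0")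
  case True
  have "(b \<bullet> c) *\<^sub>R b - (b \<bullet> b) *\<^sub>R c = b \<times> (b \<times> c)" by (simp add: Lagrange)
  also have "\<dots> = 0" using True by simp
  finally have "0 *\<^sub>R a + (b \<bullet> c) *\<^sub>R b + (- (b \<bullet> b)) *\<^sub>R c = 0" by simp
  moreover have "(0, b \<bullet> c, - (b \<bullet> b)) \<noteq> (0, 0, 0)" using assms by simp
  ultimately show ?thesis using that by blast
next
  case False
  define n where "n = b \<times> c"
  \<comment> \<open>Cramer's rule, valid for every \<open>n\<close>. Choosing
    \<open>b \<times> c\<close> makes the first coefficient a nonzero square.\<close>
  have "((b \<times> c) \<bullet> n) *\<^sub>R a + ((c \<times> a) \<bullet> n) *\<^sub>R b + ((a \<times> b) \<bullet> n) *\<^sub>R c = (a \<bullet> (b \<times> c)) *\<^sub>R n" for n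
    by (simp add: vec_eq_iff forall_3 cross3_def inner_vec_def sum_3 vector_3 algebra_simps)
  from this[of n] have "((b \<times> c) \<bullet> n) *\<^sub>R a + ((c \<times> a) \<bullet> n) *\<^sub>R b + ((a \<times> b) \<bullet> n) *\<^sub>R c = 0"
    using assms by simp
  moreover have "(b \<times> c) \<bullet> n \<noteq> 0" using False by (simp add: n_def)
  ultimately show ?thesis using that by blast
qed

text \<open>A vanishing imaginary part makes the vectors dependent. By \<open>hull\<close> the
  coefficients of a relation have mixed signs, so one vector is a nonnegative combination of the
  other two, and then \<open>tri_re\<close> factors into positive terms.\<close>

lemma tri_cx_not_nonpos:
  fixes a b c :: "real^3"
  assumes hull: "\<And>x y z. x \<ge> 0 \<Longrightarrow> y \<ge> 0 \<Longrightarrow> z \<ge> 0 \<Longrightarrow> x + y + z > 0 \<Longrightarrow> x *\<^sub>R a + y *\<^sub>R b + z *\<^sub>R c \<noteq> 0"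
  shows "tri_cx a b c \<notin> \<real>\<^sub>\<le>\<^sub>0"
proof
  assume "tri_cx a b c \<in> \<real>\<^sub>\<le>\<^sub>0"
  then have re: "tri_re a b c \<le> 0" and im: "a \<bullet> (b \<times> c) = 0"
    by (simp_all add: complex_nonpos_Reals_iff tri_cx_def)
  have nz: "a \<noteq> 0" "b \<noteq> 0" "c \<noteq> 0"
    using hull[of 1 0 0] hull[of 0 1 0] hull[of 0 0 1] by auto
  have pos: "norm a * norm b + a \<bullet> b > 0" "norm b * norm c + b \<bullet> c > 0" "norm c * norm a + c \<bullet> a > 0"
  proof -
    have "norm b *\<^sub>R a + norm a *\<^sub>R b \<noteq> 0" "norm c *\<^sub>R b + norm b *\<^sub>R c \<noteq> 0" "norm a *\<^sub>R c + norm c *\<^sub>R a \<noteq> 0"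
      using hull[of "norm b" "norm a" 0] hull[of 0 "norm c" "norm b"] hull[of "norm c" 0 "norm a"] nz
      by (simp_all add: add_pos_pos add.commute)
    then show "norm a * norm b + a \<bullet> b > 0" "norm b * norm c + b \<bullet> c > 0" "norm c * norm a + c \<bullet> a > 0"
      using nz by (auto intro: norm_mult_add_inner_pos)
  qed
  have *: "tri_re a b c > 0" if c: "x *\<^sub>R a + y *\<^sub>R b + z *\<^sub>R c = 0" and xyz: "x \<ge> 0" "y \<ge> 0" "z < 0"
    and ne: "c \<noteq> 0" and ab: "norm a * norm b + a \<bullet> b > 0" for a b c :: "real^3" and x y z
  proof -
    define k l where "k = x / - z" and "l = y / - z"
    have kl: "k \<ge> 0" "l \<ge> 0" using xyz by (simp_all add: k_def l_def divide_nonneg_neg)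
    have "z *\<^sub>R c = - (x *\<^sub>R a + y *\<^sub>R b)" using c by (simp add: add_eq_0_iff)
    then have "(1 / z) *\<^sub>R z *\<^sub>R c = (1 / z) *\<^sub>R - (x *\<^sub>R a + y *\<^sub>R b)" by simp
    then have c: "c = k *\<^sub>R a + l *\<^sub>R b" using xyz by (simp add: k_def l_def algebra_simps)
    have "tri_re a b c = (norm c + k * norm a + l * norm b) * (norm a * norm b + a \<bullet> b)"
      unfolding tri_re_def by (simp add: c inner_simps power2_norm_eq_inner[symmetric] inner_commute[of b a]
          power2_eq_square algebra_simps)
    moreover have "norm c + k * norm a + l * norm b > 0" using kl ne by (simp add: add_pos_nonneg)
    ultimately show ?thesis using ab by simp
  qed
  have perm: "tri_re b c a = tri_re a b c" "tri_re c a b = tri_re a b c"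
    by (simp_all add: tri_re_def algebra_simps)
  obtain x y z where xyz: "(x, y, z) \<noteq> (0, 0, 0)" "x *\<^sub>R a + y *\<^sub>R b + z *\<^sub>R c = 0"
    using linear_dependence_of_triple_product_eq_0[OF im nz(2)] by blast
  have one_neg: False
    if e: "x *\<^sub>R a + y *\<^sub>R b + z *\<^sub>R c = 0"
    and sgn: "x \<ge> 0 \<and> y \<ge> 0 \<and> z < 0 \<or> z \<ge> 0 \<and> x \<ge> 0 \<and> y < 0 \<or> y \<ge> 0 \<and> z \<ge> 0 \<and> x < 0" for x y z
  proof -
    have e': "y *\<^sub>R b + z *\<^sub>R c + x *\<^sub>R a = 0" "z *\<^sub>R c + x *\<^sub>R a + y *\<^sub>R b = 0"
      using e by (simp_all add: add_ac)
    from sgn have "tri_re a b c > 0"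
    proof (elim disjE conjE)
      assume "x \<ge> 0" "y \<ge> 0" "z < 0" then show ?thesis using *[OF e _ _ _ nz(3) pos(1)] by blast
    next
      assume "z \<ge> 0" "x \<ge> 0" "y < 0" then show ?thesis using *[OF e'(2) _ _ _ nz(2) pos(3)] perm by simp
    next
      assume "y \<ge> 0" "z \<ge> 0" "x < 0" then show ?thesis using *[OF e'(1) _ _ _ nz(1) pos(2)] perm by simp
    qed
    with re show False by simp
  qed
  have "(- x) *\<^sub>R a + (- y) *\<^sub>R b + (- z) *\<^sub>R c = - (x *\<^sub>R a + y *\<^sub>R b + z *\<^sub>R c)"
    by simp
  then have neg: "(- x) *\<^sub>R a + (- y) *\<^sub>R b + (- z) *\<^sub>R c = 0"
    using xyz(2) by simp
  \<comment> \<open>Equal signs contradict \<open>hull\<close>. Otherwise, possibly after negating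
    the relation, exactly one coefficient is negative.\<close>
  consider "x \<ge> 0 \<and> y \<ge> 0 \<and> z \<ge> 0" | "x \<le> 0 \<and> y \<le> 0 \<and> z \<le> 0"
    | "x \<ge> 0 \<and> y \<ge> 0 \<and> z < 0 \<or> z \<ge> 0 \<and> x \<ge> 0 \<and> y < 0 \<or> y \<ge> 0 \<and> z \<ge> 0 \<and> x < 0"
    | "- x \<ge> 0 \<and> - y \<ge> 0 \<and> - z < 0 \<or> - z \<ge> 0 \<and> - x \<ge> 0 \<and> - y < 0 \<or> - y \<ge> 0 \<and> - z \<ge> 0 \<and> - x < 0"
    by linarith
  then show False
  proof cases
    case 1
    then have "x + y + z > 0" using xyz(1) by (simp; linarith)
    then show False using hull[of x y z] 1 xyz(2) by simp
  next
    case 2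
    then have "(- x) + (- y) + (- z) > 0" using xyz(1) by (simp; linarith)
    then show False using hull[of "- x" "- y" "- z"] 2 neg by linarith
  next
    case 3
    then show False by (rule one_neg[OF xyz(2)])
  next
    case 4
    then show False by (rule one_neg[OF neg])
  qed
qed

section \<open>Triples\<close>

lemma cis_eq_imp_eq:
  assumes "cis a = cis b" "\<bar>a - b\<bar> < 2 * pi"
  shows "a = b"
proof -
  obtain n :: int where n: "a = b + 2 * pi * n" using assms(1) unfolding cis_eq_cis_iff by blast
  then have "2 * pi * \<bar>real_of_int n\<bar> < 2 * pi * 1" using assms(2) by (simp add: abs_mult)
  then have "\<bar>real_of_int n\<bar> < 1" by (subst (asm) mult_less_cancel_left_pos) simp_all
  then have "n = 0" by linarith
  with n show ?thesis by simp
qed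

text \<open>The convention on the real axis fits the range \<open>(-\<pi>, \<pi>]\<close>: the
  negative axis has argument \<open>\<pi>\<close> and counts as upper, the positive axis has
  argument 0 and counts as lower.\<close>

lemma half_plane_sign_eq_Arg:
  "(x, y) \<noteq> (0, 0) \<Longrightarrow> half_plane_sign x y = (if Arg (Complex x y) > 0 then 1 else - 1)"
  by (auto simp: half_plane_sign_def Arg_pos_iff)

definition triple_cx :: "triple \<Rightarrow> complex" where
  "triple_cx = (\<lambda>(x, y, \<sigma>). Complex x y)"

lemma is_triple_iff: "is_triple t \<longleftrightarrow> triple_cx t \<noteq> 0"
  by (auto simp: is_triple_def triple_cx_def complex_eq_iff split: prod.splits)

lemma triple_angle_eq_Arg: "is_triple t \<Longrightarrow> triple_angle t = Arg (triple_cx t) + 2 * pi * of_int (snd (snd t))"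
  by (auto simp: is_triple_def triple_cx_def triple_angle_def atan2_eq_Arg)

lemma triple_cx_add: "triple_cx (triple_add a s t) = of_real a * (triple_cx s * triple_cx t)"
  by (auto simp: triple_add_def triple_cx_def complex_eq_iff Let_def algebra_simps split: prod.splits)

lemma is_triple_add: "a > 0 \<Longrightarrow> is_triple s \<Longrightarrow> is_triple t \<Longrightarrow> is_triple (triple_add a s t)"
  by (simp add: is_triple_iff triple_cx_add)

lemma cis_add_two_pi_int: "cis (a + 2 * pi * of_int n) = cis a"
  unfolding cis_eq_cis_iff by blast

text \<open>Both sides agree modulo a full turn. \<open>crossing\<close> is nonzero just when two
  arguments from one half plane add up to a product in the other, and this keeps the discrepancy
  strictly below a full turn.\<close>

lemma triple_angle_add:
  assumes a: "a > 0" and s: "is_triple s" and t: "is_triple t"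
  shows "triple_angle (triple_add a s t) = triple_angle s + triple_angle t"
proof -
  obtain x y m x' y' n where st: "s = (x, y, m)" "t = (x', y', n)" by (metis prod_cases3)
  define v where "v = triple_cx (triple_add a s t)"
  define c where "c = crossing x y x' y' (Re v) (Im v)"
  have add: "triple_add a s t = (Re v, Im v, m + n + c)"
    by (simp add: v_def c_def st triple_add_def triple_cx_def Let_def)
  define z w where "z = triple_cx s" and "w = triple_cx t"
  have zw: "z = Complex x y" "w = Complex x' y'" by (simp_all add: z_def w_def st triple_cx_def)
  have nz: "z \<noteq> 0" "w \<noteq> 0" "v \<noteq> 0"
    using s t is_triple_add[OF assms] by (simp_all add: is_triple_iff z_def w_def v_def)
  have vzw: "v = of_real a * (z * w)" by (simp add: v_def triple_cx_add z_def w_def)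
  have "cis (Arg v + 2 * pi * of_int c) = cis (Arg z + Arg w)"
    unfolding cis_add_two_pi_int using nz a
    by (simp add: cis_Arg vzw sgn_mult sgn_of_real cis_mult[symmetric])
  moreover have "\<bar>Arg v + 2 * pi * of_int c - (Arg z + Arg w)\<bar> < 2 * pi"
  proof -
    have hs: "half_plane_sign x y = (if Arg z > 0 then 1 else - 1)"
      "half_plane_sign x' y' = (if Arg w > 0 then 1 else - 1)"
      "half_plane_sign (Re v) (Im v) = (if Arg v > 0 then 1 else - 1)"
      using nz half_plane_sign_eq_Arg[of x y] half_plane_sign_eq_Arg[of x' y'] half_plane_sign_eq_Arg[of "Re v" "Im v"]
      by (auto simp: zw complex_eq_iff)
    have c: "c = (if Arg z > 0 \<and> Arg w > 0 \<and> Arg v \<le> 0 then 1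
        else if Arg z \<le> 0 \<and> Arg w \<le> 0 \<and> Arg v > 0 then - 1 else 0)"
      unfolding c_def crossing_def hs by auto
    show ?thesis unfolding c
      using Arg_bounded[of v] Arg_bounded[of z] Arg_bounded[of w] by (auto simp: abs_less_iff)
  qed
  ultimately have "Arg v + 2 * pi * of_int c = Arg z + Arg w" by (rule cis_eq_imp_eq)
  moreover have "triple_angle s = Arg z + 2 * pi * of_int m" "triple_angle t = Arg w + 2 * pi * of_int n"
    using triple_angle_eq_Arg[OF s] triple_angle_eq_Arg[OF t] unfolding z_def w_def by (simp_all add: st)
  moreover have "triple_angle (triple_add a s t) = Arg v + 2 * pi * of_int (m + n + c)"
    using triple_angle_eq_Arg[OF is_triple_add[OF assms]] unfolding v_def[symmetric] by (simp add: add)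
  ultimately show ?thesis by (simp add: algebra_simps)
qed

text \<open>Positive scalings leave angles alone and alter the planar part only by a positive
  factor, so one induction tracks the angle and the direction together.\<close>

lemma triple_sum_correct:
  assumes "n \<ge> 1" "\<And>k. a k > 0" "\<And>k. k \<in> {1..n} \<Longrightarrow> is_triple (f k)"
  shows "is_triple (triple_sum a f n) \<and> triple_angle (triple_sum a f n) = (\<Sum>k=1..n. triple_angle (f k)) \<and>
    (\<exists>c>0. triple_cx (triple_sum a f n) = of_real c * (\<Prod>k=1..n. triple_cx (f k)))"
  using assms(1,3)
proof (induction n rule: nat_induct_at_least)
  case base
  then show ?case by (auto intro: exI[of _ 1])
next
  case (Suc n)
  then obtain c where c: "c > 0" "triple_cx (triple_sum a f n) = of_real c * (\<Prod>k=1..n. triple_cx (f k))"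
    and IH: "is_triple (triple_sum a f n)" "triple_angle (triple_sum a f n) = (\<Sum>k=1..n. triple_angle (f k))"
    by auto
  have f: "is_triple (f (Suc n))" using Suc by simp
  have eq: "triple_sum a f (Suc n) = triple_add (a (Suc n)) (triple_sum a f n) (f (Suc n))"
    using Suc by simp
  have "triple_cx (triple_sum a f (Suc n)) = of_real (a (Suc n) * c) * (\<Prod>k=1..Suc n. triple_cx (f k))"
    unfolding eq triple_cx_add c by (simp add: mult_ac)
  moreover have "a (Suc n) * c > 0" using c assms(2) by simp
  ultimately have "\<exists>c>0. triple_cx (triple_sum a f (Suc n)) = of_real c * (\<Prod>k=1..Suc n. triple_cx (f k))"
    by blast
  moreover have "triple_angle (triple_sum a f (Suc n)) = (\<Sum>k=1..Suc n. triple_angle (f k))"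
    unfolding eq triple_angle_add[OF assms(2) IH(1) f] IH(2) by simp
  moreover have "is_triple (triple_sum a f (Suc n))"
    unfolding eq by (rule is_triple_add[OF assms(2) IH(1) f])
  ultimately show ?case by blast
qed

section \<open>Holonomy around the torus of index pairs\<close>

lemma prod_cyclic_shift:
  fixes f :: "nat \<Rightarrow> 'a::comm_monoid_mult"
  assumes "n \<ge> 1" "f (n + 1) = f 1"
  shows "(\<Prod>k=1..n. f (k + 1)) = (\<Prod>k=1..n. f k)"
proof -
  obtain m where n: "n = Suc m" using assms(1) by (cases n) auto
  have "(\<Prod>k=1..n. f k) = f 1 * (\<Prod>k=1..m. f (k + 1))"
    unfolding n by (simp add: prod.atLeast_Suc_atMost prod.shift_bounds_cl_Suc_ivl del: prod.cl_ivl_Suc)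
  also have "\<dots> = (\<Prod>k=1..n. f (k + 1))"
    using assms(2) by (simp add: n mult.commute)
  finally show ?thesis ..
qed

lemma torus_holonomy:
  fixes w :: "nat \<Rightarrow> nat \<Rightarrow> real^3"
  assumes N: "N \<ge> 1" and M: "M \<ge> 1"
    and wN: "\<And>j. w (N + 1) j = w 1 j" and wM: "\<And>i. w i (M + 1) = w i 1"
  obtains k where "k \<ge> 0"
    "(\<Prod>i=1..N. \<Prod>j=1..M. holonomy (w i j) (w (i + 1) j) (w (i + 1) (j + 1)) (w i (j + 1))) = of_real k"
proof -
  define A where "A i j = spin_inner (w i j) (w (i + 1) j)" for i j
  define B where "B i j = spin_inner (w i j) (w i (j + 1))" for i j
  define PA PB where "PA = (\<Prod>i=1..N. \<Prod>j=1..M. A i j)" and "PB = (\<Prod>i=1..N. \<Prod>j=1..M. B i j)"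
  have hol: "holonomy (w i j) (w (i + 1) j) (w (i + 1) (j + 1)) (w i (j + 1)) =
      A i j * B (i + 1) j * cnj (A i (j + 1)) * cnj (B i j)" for i j
    unfolding holonomy_def A_def B_def cnj_spin_inner ..
  \<comment> \<open>By periodicity the shifted products run over the same edges, so
    \<open>PA\<close> and \<open>PB\<close> each meet their own conjugate.\<close>
  have 1: "(\<Prod>i=1..N. \<Prod>j=1..M. A i (j + 1)) = PA"
    unfolding PA_def by (intro prod.cong refl prod_cyclic_shift M) (simp only: A_def wM)
  have 2: "(\<Prod>i=1..N. \<Prod>j=1..M. B (i + 1) j) = PB"
    unfolding PB_def by (intro prod_cyclic_shift[OF N] prod.cong refl) (simp only: B_def wN)
  have "(\<Prod>i=1..N. \<Prod>j=1..M. holonomy (w i j) (w (i + 1) j) (w (i + 1) (j + 1)) (w i (j + 1))) = PA * PB * cnj PA * cnj PB"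
    unfolding hol prod.distrib cnj_prod[symmetric] 1 2 PA_def[symmetric] PB_def[symmetric] ..
  also have "\<dots> = (PA * cnj PA) * (PB * cnj PB)" by simp
  also have "\<dots> = of_real ((cmod PA)\<^sup>2 * (cmod PB)\<^sup>2)"
    unfolding complex_norm_square[symmetric] of_real_mult by simp
  finally show ?thesis using that[of "(cmod PA)\<^sup>2 * (cmod PB)\<^sup>2"] by simp
qed

section \<open>The triple of one pair of edges\<close>

lemma tri_cx_scale:
  assumes "x > 0" "y > 0" "z > 0"
  shows "tri_cx (x *\<^sub>R a) (y *\<^sub>R b) (z *\<^sub>R c) = of_real (x * y * z) * tri_cx a b c"
  using assms by (simp add: tri_cx_def tri_re_def complex_eq_iff cross_mult_left cross_mult_right algebra_simps)

text \<open>When \<open>P\<close> and \<open>Q\<close> lie on opposite sides of the real axis, the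
  sign of \<open>Arg P - Arg Q\<close> is known, but its size may exceed \<open>pi\<close>. The
  correction adds the full turn that brings \<open>Arg z\<close> to the right sign.\<close>

lemma triple_angle_cnj_mult:
  fixes P Q :: complex
  assumes nP: "P \<notin> \<real>\<^sub>\<le>\<^sub>0" and nQ: "Q \<notin> \<real>\<^sub>\<le>\<^sub>0"
    and opp: "Im P * Im Q < 0 \<or> Im P = 0 \<and> Im Q = 0"
  defines "z \<equiv> cnj Q * P"
  shows "triple_angle (Re z, Im z, if of_int (half_plane_sign (Re z) (Im z)) * Im Q > 0
      then - half_plane_sign (Re z) (Im z) else 0) = Arg P - Arg Q"
    (is "triple_angle (_, _, ?c) = _")
proof -
  have nz: "P \<noteq> 0" "Q \<noteq> 0" "z \<noteq> 0" using nP nQ by (auto simp: z_def)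
  have "triple_angle (Re z, Im z, ?c) = Arg z + 2 * pi * of_int ?c"
    using nz by (subst triple_angle_eq_Arg) (auto simp: is_triple_iff triple_cx_def)
  also have "\<dots> = Arg P - Arg Q"
  proof (rule cis_eq_imp_eq)
    show "cis (Arg z + 2 * pi * of_int ?c) = cis (Arg P - Arg Q)"
      unfolding cis_add_two_pi_int cis_Arg_diff[OF nz(1,2)] using nz
      by (simp add: cis_Arg z_def sgn_div_norm norm_mult scaleR_conv_of_real divide_inverse mult_ac)
    have hs: "half_plane_sign (Re z) (Im z) = (if Arg z > 0 then 1 else - 1)"
      using nz half_plane_sign_eq_Arg[of "Re z" "Im z"] by (auto simp: complex_eq_iff)
    from opp consider "Im Q > 0" "Im P < 0" | "Im Q < 0" "Im P > 0" | "Im Q = 0" "Im P = 0"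
      by (auto simp: mult_less_0_iff)
    then show "\<bar>Arg z + 2 * pi * of_int ?c - (Arg P - Arg Q)\<bar> < 2 * pi"
    proof cases
      case 1
      then have "0 < Arg Q \<and> Arg Q < pi" "- pi < Arg P \<and> Arg P < 0"
        using Arg_lt_pi[of Q] Arg_neg_iff[of P] Arg_bounded[of P] by auto
      then show ?thesis using 1 Arg_bounded[of z] unfolding hs by (auto simp: abs_less_iff)
    next
      case 2
      then have "0 < Arg P \<and> Arg P < pi" "- pi < Arg Q \<and> Arg Q < 0"
        using Arg_lt_pi[of P] Arg_neg_iff[of Q] Arg_bounded[of Q] by auto
      then show ?thesis using 2 Arg_bounded[of z] unfolding hs by (auto simp: abs_less_iff)
    next
      case 3
      then have "Arg P = 0" "Arg Q = 0"
        using nP nQ by (simp_all add: Arg_eq_0 complex_nonpos_Reals_iff complex_is_Real_iff)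
      then show ?thesis using 3 Arg_bounded[of z] pi_gt_zero by (auto simp: abs_less_iff)
    qed
  qed
  finally show ?thesis .
qed

text \<open>The planar part of \<open>tri\<close> is \<open>cnj Q * P\<close>, with \<open>Q\<close>
  and \<open>P\<close> the numbers of the two triangles on the common diagonal; normalising the
  vectors costs only positive factors.\<close>

lemma tri_eq:
  assumes "q \<noteq> p" "q \<noteq> p'" "q' \<noteq> p'" "q' \<noteq> p"
  shows "\<exists>k>0. \<exists>l>0. tri p p' q q' =
     (let P = of_real k * tri_cx (q - p) (q' - p') (q' - p); Q = of_real l * tri_cx (q - p) (q' - p') (q - p');
          z = cnj Q * P
      in (Re z, Im z, if of_int (half_plane_sign (Re z) (Im z)) * Im Q > 0
            then - half_plane_sign (Re z) (Im z) else 0))"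
proof -
  define \<alpha> \<beta> \<gamma> \<omega> where defs: "\<alpha> = (q - p) /\<^sub>R norm (q - p)" "\<beta> = (q - p') /\<^sub>R norm (q - p')"
    "\<gamma> = (q' - p') /\<^sub>R norm (q' - p')" "\<omega> = (q' - p) /\<^sub>R norm (q' - p)"
  have n: "norm \<alpha> = 1" "norm \<beta> = 1" "norm \<gamma> = 1" "norm \<omega> = 1"
    unfolding defs using assms by simp_all
  define P Q where "P = tri_cx \<alpha> \<gamma> \<omega>" and "Q = tri_cx \<alpha> \<gamma> \<beta>"
  have P: "Re P = 1 + \<alpha> \<bullet> \<gamma> + \<alpha> \<bullet> \<omega> + \<omega> \<bullet> \<gamma>" "Im P = \<omega> \<bullet> (\<alpha> \<times> \<gamma>)"
    by (simp_all add: P_def tri_cx_def tri_re_def n inner_commute) (simp add: cross3_def inner_vec_def sum_3 vector_3 algebra_simps)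
  have Q: "Re Q = 1 + \<alpha> \<bullet> \<gamma> + \<alpha> \<bullet> \<beta> + \<beta> \<bullet> \<gamma>" "Im Q = \<beta> \<bullet> (\<alpha> \<times> \<gamma>)"
    by (simp_all add: Q_def tri_cx_def tri_re_def n inner_commute) (simp add: cross3_def inner_vec_def sum_3 vector_3 algebra_simps)
  have "Re (cnj Q * P) = Re Q * Re P + Im Q * Im P" "Im (cnj Q * P) = Re Q * Im P - Im Q * Re P"
    by simp_all
  then have "tri p p' q q' = (let z = cnj Q * P in (Re z, Im z,
      if of_int (half_plane_sign (Re z) (Im z)) * Im Q > 0 then - half_plane_sign (Re z) (Im z) else 0))"
    unfolding tri_def defs[symmetric] Let_def P Q by simp
  moreover have "P = of_real (inverse (norm (q - p)) * inverse (norm (q' - p')) * inverse (norm (q' - p))) * tri_cx (q - p) (q' - p') (q' - p)"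
    unfolding P_def defs by (rule tri_cx_scale) (use assms in simp_all)
  moreover have "Q = of_real (inverse (norm (q - p)) * inverse (norm (q' - p')) * inverse (norm (q - p'))) * tri_cx (q - p) (q' - p') (q - p')"
    unfolding Q_def defs by (rule tri_cx_scale) (use assms in simp_all)
  ultimately show ?thesis unfolding Let_def
    by (intro exI[of _ "inverse (norm (q - p)) * inverse (norm (q' - p')) * inverse (norm (q' - p))"] conjI
      exI[of _ "inverse (norm (q - p)) * inverse (norm (q' - p')) * inverse (norm (q - p'))"])
      (use assms in simp_all)
qed

lemma tri_correct:
  fixes p p' q q' :: "real^3"
  assumes disj: "\<And>s t. s \<in> {0..1} \<Longrightarrow> t \<in> {0..1} \<Longrightarrow> p + t *\<^sub>R (p' - p) \<noteq> q + s *\<^sub>R (q' - q)"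
  shows "is_triple (tri p p' q q')"
    and "gauss_angle p p' q q' = triple_angle (tri p p' q q')"
    and "\<exists>k>0. triple_cx (tri p p' q q') = of_real k * holonomy (q - p) (q - p') (q' - p') (q' - p)"
proof -
  define r u v where "r = q - p" and "u = q' - q" and "v = p - p'"
  have eqs: "q - p = r" "q - p' = r + v" "q' - p' = r + u + v" "q' - p = r + u"
    by (simp_all add: r_def u_def v_def)
  have ne: "r + s *\<^sub>R u + t *\<^sub>R v \<noteq> 0" if "s \<in> {0..1}" "t \<in> {0..1}" for s t
    using disj[OF that] by (auto simp: r_def u_def v_def algebra_simps)
  have ne4: "q \<noteq> p" "q \<noteq> p'" "q' \<noteq> p'" "q' \<noteq> p"
    using ne[of 0 0] ne[of 0 1] ne[of 1 1] ne[of 1 0] by (simp_all add: r_def u_def v_def)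
  define P0 Q0 where "P0 = tri_cx r (r + u + v) (r + u)" and "Q0 = tri_cx r (r + u + v) (r + v)"
  \<comment> \<open>A nonnegative combination of three corners is a positive multiple of a point of
    the parallelogram, which misses the origin because the segments are disjoint.\<close>
  have cone: "x *\<^sub>R r + y *\<^sub>R (r + u + v) + z *\<^sub>R (r + u) \<noteq> 0" "x *\<^sub>R r + y *\<^sub>R (r + u + v) + z *\<^sub>R (r + v) \<noteq> 0"
    if "x \<ge> 0" "y \<ge> 0" "z \<ge> 0" "x + y + z > 0" for x y z
  proof -
    define S where "S = x + y + z"
    have S: "S > 0" using that by (simp add: S_def)
    have "x *\<^sub>R r + y *\<^sub>R (r + u + v) + z *\<^sub>R (r + u) = S *\<^sub>R (r + ((y + z) / S) *\<^sub>R u + (y / S) *\<^sub>R v)"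
      "x *\<^sub>R r + y *\<^sub>R (r + u + v) + z *\<^sub>R (r + v) = S *\<^sub>R (r + (y / S) *\<^sub>R u + ((y + z) / S) *\<^sub>R v)"
      using S by (simp_all add: scaleR_add_right) (simp_all add: S_def algebra_simps)
    moreover have "(y + z) / S \<in> {0..1}" "y / S \<in> {0..1}" using that S by (auto simp: S_def)
    ultimately show "x *\<^sub>R r + y *\<^sub>R (r + u + v) + z *\<^sub>R (r + u) \<noteq> 0" "x *\<^sub>R r + y *\<^sub>R (r + u + v) + z *\<^sub>R (r + v) \<noteq> 0"
      using S ne by simp_all
  qed
  have nP0: "P0 \<notin> \<real>\<^sub>\<le>\<^sub>0" and nQ0: "Q0 \<notin> \<real>\<^sub>\<le>\<^sub>0"
    unfolding P0_def Q0_def by (intro tri_cx_not_nonpos cone; assumption)+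
  \<comment> \<open>The two triangles lie on opposite sides of their common diagonal, hence opposite
    signs.\<close>
  have Im0: "Im P0 = - (r \<bullet> (u \<times> v))" "Im Q0 = r \<bullet> (u \<times> v)"
    by (simp_all add: P0_def Q0_def tri_cx_def cross3_def inner_vec_def sum_3 vector_3 algebra_simps)
  obtain k l where kl: "k > 0" "l > 0"
    and tri: "tri p p' q q' =
     (let P = of_real k * P0; Q = of_real l * Q0; z = cnj Q * P
      in (Re z, Im z, if of_int (half_plane_sign (Re z) (Im z)) * Im Q > 0
            then - half_plane_sign (Re z) (Im z) else 0))"
    using tri_eq[OF ne4] unfolding eqs P0_def[symmetric] Q0_def[symmetric] by blast
  have cx: "triple_cx (tri p p' q q') = of_real (k * l) * (cnj Q0 * P0)"
    unfolding tri Let_def triple_cx_def by (simp add: complex_eq_iff algebra_simps)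
  have nz: "P0 \<noteq> 0" "Q0 \<noteq> 0" using nP0 nQ0 by auto
  then show "is_triple (tri p p' q q')" using kl by (simp add: is_triple_iff cx)
  have "triple_angle (tri p p' q q') = Arg (of_real k * P0) - Arg (of_real l * Q0)"
    unfolding tri Let_def
  proof (rule triple_angle_cnj_mult)
    show "of_real k * P0 \<notin> \<real>\<^sub>\<le>\<^sub>0" "of_real l * Q0 \<notin> \<real>\<^sub>\<le>\<^sub>0"
      using nP0 nQ0 kl by (auto simp: complex_nonpos_Reals_iff mult_le_0_iff)
    have *: "Im (of_real k * P0) * Im (of_real l * Q0) = - (k * l * (r \<bullet> (u \<times> v))\<^sup>2)"
      by (simp add: Im0 power2_eq_square)
    show "Im (of_real k * P0) * Im (of_real l * Q0) < 0 \<or> Im (of_real k * P0) = 0 \<and> Im (of_real l * Q0) = 0"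
    proof (cases "r \<bullet> (u \<times> v) = 0")
      case False
      then have "k * l * (r \<bullet> (u \<times> v))\<^sup>2 > 0" using kl by simp
      then show ?thesis unfolding * by simp
    qed (simp add: Im0)
  qed
  also have "\<dots> = Arg P0 - Arg Q0" using kl by simp
  also have "\<dots> = gauss_angle p p' q q'"
  proof -
    have "2 * gauss_angle p p' q q' = (if r \<bullet> (u \<times> v) = 0 then 0 else corner_angle_sum u v r 1)"
      unfolding r_def u_def v_def by (rule gauss_angle_has_integral[of p p' q q'])
    \<comment> \<open>Coplanar edges: both numbers are real and off the nonpositive axis, so their
      arguments are 0, like the Gauss integral.\<close>
    moreover have "Arg P0 = 0" "Arg Q0 = 0" if "r \<bullet> (u \<times> v) = 0"
      using that nP0 nQ0 Im0 by (simp_all add: Arg_eq_0 complex_nonpos_Reals_iff complex_is_Real_iff)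
    ultimately show ?thesis
      using corner_angle_sum_eq_Arg[of r u v] unfolding P0_def Q0_def by (auto split: if_splits)
  qed
  finally show "gauss_angle p p' q q' = triple_angle (tri p p' q q')" ..
  define m where "m = (norm r * norm (r + u + v) + r \<bullet> (r + u + v)) / 2"
  have m: "cnj Q0 * P0 = of_real m * holonomy r (r + v) (r + u + v) (r + u)"
    unfolding P0_def Q0_def m_def by (rule cnj_tri_cx_mult_tri_cx)
  have "m \<ge> 0" unfolding m_def using Cauchy_Schwarz_ineq2[of r "r + u + v"] by (simp add: abs_le_iff)
  \<comment> \<open>Cauchy-Schwarz is strict here because \<open>P0\<close> and \<open>Q0\<close>
    are nonzero.\<close>
  moreover have "m \<noteq> 0" using m nz by auto
  ultimately have "k * l * m > 0" using kl by simp
  then show "\<exists>k>0. triple_cx (tri p p' q q') = of_real k * holonomy (q - p) (q - p') (q' - p') (q' - p)"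
    unfolding cx m eqs by (intro exI[of _ "k * l * m"]) simp
qed

section \<open>The linking number\<close>

lemma has_integral_unit_intervals:
  fixes f :: "real \<Rightarrow> 'a::banach"
  assumes "\<And>i. i \<in> {1..n} \<Longrightarrow> (f has_integral I i) {real i..real i + 1}"
  shows "(f has_integral (\<Sum>i=1..n. I i)) {1..real n + 1}"
  using assms
proof (induction n)
  case 0
  then show ?case using has_integral_refl(2)[of f 1] by simp
next
  case (Suc n)
  have "(f has_integral (\<Sum>i=1..n. I i)) {1..real n + 1}" using Suc by simp
  moreover have "(f has_integral I (Suc n)) {real n + 1..real (Suc n) + 1}"
    using Suc.prems[of "Suc n"] by (simp add: add.commute)
  ultimately have "(f has_integral ((\<Sum>i=1..n. I i) + I (Suc n))) {1..real (Suc n) + 1}"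
    by (intro has_integral_combine[of 1 "real n + 1"]) simp_all
  then show ?case by simp
qed

text \<open>Agreement is asked only inside the interval, since at the corners of a curve the
  derivative is unspecified.\<close>

lemma has_integral_unit_shift:
  fixes f g :: "real \<Rightarrow> 'a::euclidean_space"
  assumes f: "(f has_integral I) {0..1}"
    and g: "\<And>x. a < x \<Longrightarrow> x < a + 1 \<Longrightarrow> g x = f (x - a)"
  shows "(g has_integral I) {a..a + 1}"
proof -
  have "((\<lambda>x. f (1 *\<^sub>R x + (- a))) has_integral I) ((\<lambda>x. x + a) ` {0..1})"
    using has_integral_affinity[of f I 0 1 1 "- a"] f by simp
  then have "((\<lambda>x. f (x - a)) has_integral I) (cbox a (a + 1))"
    by (simp add: add.commute)
  then have "(g has_integral I) (cbox a (a + 1))"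
    by (rule has_integral_spike_interior) (simp add: g)
  then show ?thesis by simp
qed

lemma polygonal_curve_vector_derivative:
  assumes "real i < t" "t < real i + 1"
  shows "vector_derivative (polygonal_curve p) (at t) = p (i + 1) - p i"
proof (rule vector_derivative_at)
  have "((\<lambda>t. p i + (t - real i) *\<^sub>R (p (i + 1) - p i)) has_vector_derivative p (i + 1) - p i) (at t)"
    by (auto intro!: derivative_eq_intros)
  then show "(polygonal_curve p has_vector_derivative p (i + 1) - p i) (at t)"
  proof (rule has_vector_derivative_transform_within_open[of _ _ _ "{real i<..<real i + 1}"])
    show "p i + (x - real i) *\<^sub>R (p (i + 1) - p i) = polygonal_curve p x" if "x \<in> {real i<..<real i + 1}" for x
      using that polygonal_curve_on_edge[of i x p] by simp
  qed (use assms in auto)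
qed

text \<open>On a product of two open edges the integrand is a shifted
  \<open>gauss_integrand\<close>, whose double integral is twice the angle; this turns
  \<open>1 / (4 * pi)\<close> into \<open>1 / (2 * pi)\<close>.\<close>

lemma linking_number_eq_sum:
  "linking_number N M p q = (\<Sum>i=1..N. \<Sum>j=1..M. gauss_angle (p i) (p (i + 1)) (q j) (q (j + 1))) / (2 * pi)"
proof -
  define F where "F t s = ((polygonal_curve q s - polygonal_curve p t) \<bullet>
        (vector_derivative (polygonal_curve q) (at s) \<times> vector_derivative (polygonal_curve p) (at t)))
       / norm (polygonal_curve q s - polygonal_curve p t) ^ 3" for t s
  have "\<exists>h. (\<forall>t. (gauss_integrand (p i) (p (i + 1)) (q j) (q (j + 1)) t has_integral h t) {0..1}) \<and>
      (h has_integral 2 * gauss_angle (p i) (p (i + 1)) (q j) (q (j + 1))) {0..1}" for i j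
    by (rule gauss_angle_has_integral) blast
  then obtain h where h: "\<And>i j t. (gauss_integrand (p i) (p (i + 1)) (q j) (q (j + 1)) t has_integral h i j t) {0..1}"
    "\<And>i j. (h i j has_integral 2 * gauss_angle (p i) (p (i + 1)) (q j) (q (j + 1))) {0..1}"
    by metis
  have inner: "integral {1..real M + 1} (F t) = (\<Sum>j=1..M. h i j (t - real i))"
    if t: "real i < t" "t < real i + 1" for i t
  proof (intro integral_unique has_integral_unit_intervals has_integral_unit_shift[OF h(1)])
    fix j :: nat and s :: real
    assume s: "real j < s" "s < real j + 1"
    have eq: "q j + (s - real j) *\<^sub>R (q (j + 1) - q j) - (p i + (t - real i) *\<^sub>R (p (i + 1) - p i)) =
        q j - p i + (s - real j) *\<^sub>R (q (j + 1) - q j) - (t - real i) *\<^sub>R (p (i + 1) - p i)"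
      by simp
    then show "F t s = gauss_integrand (p i) (p (i + 1)) (q j) (q (j + 1)) (t - real i) (s - real j)"
      using s t polygonal_curve_on_edge[of j s q] polygonal_curve_on_edge[of i t p]
      unfolding F_def gauss_integrand_def eq[symmetric]
      by (simp add: polygonal_curve_vector_derivative[of j] polygonal_curve_vector_derivative[of i])
  qed
  have "((\<lambda>t. integral {1..real M + 1} (F t)) has_integral
      (\<Sum>i=1..N. \<Sum>j=1..M. 2 * gauss_angle (p i) (p (i + 1)) (q j) (q (j + 1)))) {1..real N + 1}"
  proof (rule has_integral_unit_intervals)
    fix i
    have "((\<lambda>t. \<Sum>j=1..M. h i j t) has_integral
        (\<Sum>j=1..M. 2 * gauss_angle (p i) (p (i + 1)) (q j) (q (j + 1)))) {0..1}"
      by (intro has_integral_sum h(2)) simp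
    then show "((\<lambda>t. integral {1..real M + 1} (F t)) has_integral
        (\<Sum>j=1..M. 2 * gauss_angle (p i) (p (i + 1)) (q j) (q (j + 1)))) {real i..real i + 1}"
      by (rule has_integral_unit_shift) (rule inner)
  qed
  then have "integral {1..real N + 1} (\<lambda>t. integral {1..real M + 1} (F t)) =
      2 * (\<Sum>i=1..N. \<Sum>j=1..M. gauss_angle (p i) (p (i + 1)) (q j) (q (j + 1)))"
    by (simp add: integral_unique sum_distrib_left)
  moreover have "linking_number N M p q = 1 / (4 * pi) * integral {1..real N + 1} (\<lambda>t. integral {1..real M + 1} (F t))"
    unfolding linking_number_def F_def ..
  ultimately show ?thesis by simp
qed

unbundle no cross3_syntax

theorem theorem1:
  fixes N M :: nat
    and p q :: "nat \<Rightarrow> real^3"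
    and a :: "nat \<Rightarrow> nat \<Rightarrow> real"
    and b :: "nat \<Rightarrow> real"
    and X Y :: real
    and \<sigma> :: int
  assumes "N \<ge> 1" and "M \<ge> 1"
    and closed_p: "p (N + 1) = p 1"
    and closed_q: "q (M + 1) = q 1"
    and disjoint: "polygonal_curve p ` {1..real N + 1} \<inter> polygonal_curve q ` {1..real M + 1} = {}"
    and scalings: "\<And>i j. a i j > 0" "\<And>i. b i > 0"
    and total: "(X, Y, \<sigma>) =
      triple_sum b (\<lambda>i. triple_sum (a i) (\<lambda>j. tri (p i) (p (i + 1)) (q j) (q (j + 1))) M) N"
  shows "(\<forall>i\<in>{1..N}. \<forall>j\<in>{1..M}.
            is_triple (tri (p i) (p (i + 1)) (q j) (q (j + 1))) \<and>
            gauss_angle (p i) (p (i + 1)) (q j) (q (j + 1)) =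
              triple_angle (tri (p i) (p (i + 1)) (q j) (q (j + 1))))
         \<and> X > 0 \<and> Y = 0 \<and> of_int \<sigma> = linking_number N M p q"
proof -
  define T where "T i j = tri (p i) (p (i + 1)) (q j) (q (j + 1))" for i j
  define w where "w i j = q j - p i" for i j
  define R where "R i = triple_sum (a i) (T i) M" for i
  have disj: "p i + t *\<^sub>R (p (i + 1) - p i) \<noteq> q j + s *\<^sub>R (q (j + 1) - q j)"
    if "i \<in> {1..N}" "j \<in> {1..M}" "s \<in> {0..1}" "t \<in> {0..1}" for i j s t
  proof
    assume "p i + t *\<^sub>R (p (i + 1) - p i) = q j + s *\<^sub>R (q (j + 1) - q j)"
    then have "polygonal_curve p (real i + t) = polygonal_curve q (real j + s)"
      using that polygonal_curve_on_edge[of i "real i + t" p] polygonal_curve_on_edge[of j "real j + s" q] by simp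
    moreover have "real i + t \<in> {1..real N + 1}" "real j + s \<in> {1..real M + 1}"
      using that by (auto intro: add_mono)
    ultimately show False using disjoint by blast
  qed
  have T: "is_triple (T i j)" "gauss_angle (p i) (p (i + 1)) (q j) (q (j + 1)) = triple_angle (T i j)"
    "\<exists>k>0. triple_cx (T i j) = of_real k * holonomy (w i j) (w (i + 1) j) (w (i + 1) (j + 1)) (w i (j + 1))"
    if "i \<in> {1..N}" "j \<in> {1..M}" for i j
    using tri_correct[of "p i" "p (i + 1)" "q j" "q (j + 1)"] disj[OF that] unfolding T_def w_def by blast+
  then obtain k where k: "\<And>i j. i \<in> {1..N} \<Longrightarrow> j \<in> {1..M} \<Longrightarrow> k i j > 0 \<and>
      triple_cx (T i j) = of_real (k i j) * holonomy (w i j) (w (i + 1) j) (w (i + 1) (j + 1)) (w i (j + 1))"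
    by metis
  have row: "is_triple (R i) \<and> triple_angle (R i) = (\<Sum>j=1..M. triple_angle (T i j)) \<and>
    (\<exists>c>0. triple_cx (R i) = of_real c * (\<Prod>j=1..M. triple_cx (T i j)))" if "i \<in> {1..N}" for i
    unfolding R_def using that T(1) scalings(1) by (intro triple_sum_correct[OF assms(2)])
  then obtain c where c: "\<And>i. i \<in> {1..N} \<Longrightarrow> c i > 0 \<and> triple_cx (R i) = of_real (c i) * (\<Prod>j=1..M. triple_cx (T i j))"
    by metis
  have total: "(X, Y, \<sigma>) = triple_sum b R N" using total unfolding R_def[abs_def] T_def[abs_def] .
  obtain d where sum: "is_triple (X, Y, \<sigma>)" "triple_angle (X, Y, \<sigma>) = (\<Sum>i=1..N. triple_angle (R i))"
    and d: "d > 0" "triple_cx (X, Y, \<sigma>) = of_real d * (\<Prod>i=1..N. triple_cx (R i))"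
    using triple_sum_correct[of N b R] assms(1) scalings(2) row unfolding total by blast
  obtain e where e: "e \<ge> 0"
    "(\<Prod>i=1..N. \<Prod>j=1..M. holonomy (w i j) (w (i + 1) j) (w (i + 1) (j + 1)) (w i (j + 1))) = of_real e"
    using torus_holonomy[OF assms(1,2), of w] unfolding w_def closed_p closed_q by blast
  \<comment> \<open>Positive factors from outer scalings, row scalings and single triples, times the
    nonnegative total holonomy \<open>e\<close>.\<close>
  define K where "K = d * ((\<Prod>i=1..N. c i) * (\<Prod>i=1..N. \<Prod>j=1..M. k i j) * e)"
  have "(\<Prod>i=1..N. triple_cx (R i)) = (\<Prod>i=1..N. of_real (c i) * (\<Prod>j=1..M. of_real (k i j) *
      holonomy (w i j) (w (i + 1) j) (w (i + 1) (j + 1)) (w i (j + 1))))"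
    using c k by (intro prod.cong refl) simp
  also have "\<dots> = of_real ((\<Prod>i=1..N. c i) * (\<Prod>i=1..N. \<Prod>j=1..M. k i j) * e)"
    unfolding prod.distrib e of_real_mult of_real_prod by (simp add: mult_ac)
  finally have XY: "Complex X Y = of_real K" unfolding d(2)[unfolded triple_cx_def prod.case] K_def
    by (simp add: triple_cx_def)
  have "K \<ge> 0" unfolding K_def using c k d(1) e(1) by (intro mult_nonneg_nonneg prod_nonneg) (auto simp: less_imp_le)
  moreover have "X = K" "Y = 0" using XY by (simp_all add: complex_eq_iff)
  \<comment> \<open>\<open>K\<close> is only known to be nonnegative; a triple is never at the
    origin, so \<open>K\<close> is positive.\<close>
  moreover have "X \<noteq> 0 \<or> Y \<noteq> 0" using sum(1) by (simp add: is_triple_def)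
  ultimately have X: "X > 0" "Y = 0" by auto
  \<comment> \<open>On the positive real axis the planar part contributes no angle, so the total
    angle is carried by \<open>\<sigma>\<close> alone.\<close>
  have "Arg (Complex X Y) = 0" using X by (simp add: Arg_eq_0 complex_is_Real_iff)
  then have "2 * pi * of_int \<sigma> = triple_angle (X, Y, \<sigma>)"
    using triple_angle_eq_Arg[OF sum(1)] by (simp add: triple_cx_def)
  also have "\<dots> = (\<Sum>i=1..N. \<Sum>j=1..M. triple_angle (T i j))"
    unfolding sum(2) using row by (intro sum.cong refl) simp
  also have "\<dots> = (\<Sum>i=1..N. \<Sum>j=1..M. gauss_angle (p i) (p (i + 1)) (q j) (q (j + 1)))"
    using T(2) by (intro sum.cong refl) simp
  also have "\<dots> = 2 * pi * linking_number N M p q"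
    unfolding linking_number_eq_sum by simp
  finally have "of_int \<sigma> = linking_number N M p q" by simp
  with T X show ?thesis unfolding T_def by blast
qed

end
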